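(* Let $\mathbb{F}$ be a field. Let $k$ and $h$ be positive integers such that $2 \leq h \leq k$ and $h - 1 \leq p(\mathbb{F})$. Let $A$ be a nonempty subset of $\mathbb{F}$ with $|A| = k$. Let $$\theta = 2hk - \frac{h(3h - 1)}{2} - h |A \cap (- A)|.$$ Then $$|h_{\pm}^{\wedge} A|\geq \begin{cases} \min (p(\mathbb{F}), hk - h^2 + 1), & \text{if } \min(p(\mathbb{F}), \theta + 1) \leq hk - h^2 + 1;\\ \theta + 1, & \text{if } hk - h^2 + 1 < \theta + 1 \leq p(\mathbb{F});\\ \max (hk - h^2 + 1, \theta - \ell h + 1), & \text{if } hk - h^2 + 1 < p(\mathbb{F}) < \theta + 1, \end{cases}$$ where (in the third case) $\ell$ is the least positive integer such that $$\theta - \ell h + 1 \leq p(\mathbb{F}) < \theta - (\ell - 1)h + 1.$$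
   Context: For a field $\mathbb{F}$, $p(\mathbb{F})$ denotes the order of the smallest nontrivial subgroup of the additive group of $\mathbb{F}$, or $\infty$ if there is no such finite subgroup; equivalently, $p(\mathbb{F})$ is the characteristic of $\mathbb{F}$ if it is positive and $\infty$ if the characteristic is $0$. For a finite subset $A=\{a_1,\dots,a_k\}$ (with $|A|=k$) of $\mathbb{F}$, write $-A=\{-a:a\in A\}$, and define the restricted $h$-fold signed sumset $$h_{\pm}^{\wedge}A=\Bigl\{\sum_{i=1}^k\lambda_i a_i:\lambda_i\in\{-1,0,1\},\ \sum_{i=1}^k|\lambda_i|=h\Bigr\}.$$ *)

theory Defs
  imports "HOL-Library.Extended_Real"
begin

definition additive_subgroup :: "'a::ab_group_add set \<Rightarrow> bool" where
  "additive_subgroup H \<longleftrightarrow>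
     0 \<in> H \<and> (\<forall>x\<in>H. \<forall>y\<in>H. x + y \<in> H) \<and> (\<forall>x\<in>H. - x \<in> H)"

text \<open>The infimum of the empty set of type \<^typ>\<open>enat\<close> is \<open>\<infinity>\<close>, which is the value
  wanted when there is no finite nontrivial additive subgroup.\<close>

definition min_subgroup_order :: "'a::field itself \<Rightarrow> enat" where
  "min_subgroup_order _ =
     Inf {enat (card H) | H :: 'a set. additive_subgroup H \<and> H \<noteq> {0} \<and> finite H}"

definition restricted_signed_sumset :: "nat \<Rightarrow> 'a::field set \<Rightarrow> 'a set" where
  "restricted_signed_sumset h A =
     {(\<Sum>a\<in>A. of_int (c a) * a) | c :: 'a \<Rightarrow> int.
        (\<forall>a\<in>A. c a \<in> {-1, 0, 1}) \<and> (\<Sum>a\<in>A. \<bar>c a\<bar>) = int h}"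

end

theory Submission
  imports Defs "Jordan_Normal_Form.Determinant"
begin

text \<open>
  Let \<open>p\<close> be the characteristic, read as \<open>\<infinity>\<close> if it is \<open>0\<close>; throughout, \<open>N < p\<close> is written
  \<open>of_nat (fact N) \<noteq> 0\<close>. All the bounds come from one polynomial argument
  (\<open>card_gt_if_nonsingular_sums_in\<close>). Let \<open>x\<^sub>i\<close> range over a set with \<open>c\<^sub>i + 1\<close> elements, and let
  \<open>D(x) = det (x\<^sub>i ^ e\<^sub>j)\<close>, which vanishes unless the relevant powers of the \<open>x\<^sub>i\<close> are distinct. Let
  \<open>N = \<Sum> c\<^sub>i - \<Sum> e\<^sub>j\<close>. If all sums \<open>\<Sum> x\<^sub>i\<close> with \<open>D(x) \<noteq> 0\<close> lay in a set \<open>X\<close> of at most \<open>N\<close> elements, then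
  \<open>D(x)\<close> times a monic polynomial of degree \<open>N\<close> in \<open>\<Sum> x\<^sub>i\<close> that vanishes on \<open>X\<close> would be zero on the
  whole box, so its coefficient at \<open>\<Prod> x\<^sub>i ^ c\<^sub>i\<close>, a monomial of top degree, would be zero. That
  coefficient is \<open>N! det (1 / (c\<^sub>i - e\<^sub>j)!)\<close>. Hence \<open>|X| > N\<close> as soon as \<open>N < p\<close> and this determinant is
  nonzero. Up to nonzero factors its entries are values of falling factorials, so a kernel vector is
  a polynomial with too many roots; this is how each determinant is handled.

  There are three uses. With \<open>e\<^sub>j = j\<close> the \<open>x\<^sub>i\<close> are distinct elements of \<open>A\<close>, and the result is the bound of
  Dias da Silva and Hamidoune, \<open>|R| \<ge> min p (h (k - h) + 1)\<close> for the sumset \<open>R\<close>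
  (\<open>card_restricted_signed_sumset_gt\<close>). With \<open>e\<^sub>j = 2 j\<close> the \<open>x\<^sub>i\<close> are elements of \<open>A \<union> - A\<close> with distinct
  squares, that is, signed versions of distinct elements of \<open>A\<close>. Taking the degrees \<open>c\<^sub>i\<close> to be
  \<open>n - 1, n - 2, \<dots>, n - h\<close> for some \<open>n \<le> |A \<union> - A|\<close> gives \<open>N = h n - h (3 h - 1) / 2\<close>, which is \<open>\<theta>\<close> for the largest
  \<open>n\<close> and \<open>\<theta> - \<ell> h\<close> when \<open>n\<close> is smaller by \<open>\<ell>\<close>
  (\<open>card_restricted_signed_sumset_gt_if_wide\<close>). The determinant is nonzero only if \<open>n \<ge> 2 h - 1\<close>.

  For smaller \<open>n\<close> another argument is needed, because \<open>A\<close> may have fewer than \<open>h\<close> classes modulo sign.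
  Choose \<open>d = min h \<nu>\<close> of the \<open>\<nu>\<close> nonzero classes, fix the remaining \<open>h - d\<close> summands, and vary only the
  signs of the \<open>d\<close> chosen elements. Such sums take at least \<open>min p (d (d + 1) / 2 + 1)\<close> values
  (\<open>card_sign_sums_gt\<close>, a theorem of Balandraud), and \<open>N \<le> d (d + 1) / 2\<close> by
  \<open>narrow_bound_le_triangular\<close>. To reach every value below \<open>p\<close>, and not only triangular numbers, the sequence of
  degrees has to skip one value; the corresponding determinant is governed by the coefficients of
  \<open>(u - 1) (u - 3) \<dots> (u - (2 e - 1))\<close> in the basis of falling factorials, which are, up to sign,
  coefficients of Bessel polynomials and so have only small prime factors.

  In characteristic \<open>2\<close> one has \<open>A = - A\<close>, hence \<open>\<theta> + 1 \<le> h k - h\<^sup>2 + 1\<close>, so the other two cases do not occur.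
\<close>

section \<open>Factorials in a field\<close>

lemma fact_neq_0_mono:
  assumes "of_nat (fact n) \<noteq> (0::'a::field)" "m \<le> n"
  shows "of_nat (fact m) \<noteq> (0::'a)"
proof
  assume "of_nat (fact m) = (0::'a)"
  moreover obtain r where "fact n = fact m * (r :: nat)"
    using fact_dvd[OF assms(2)] by (rule dvdE)
  then have "of_nat (fact n) = of_nat (fact m) * (of_nat r :: 'a)"
    by (simp only: of_nat_mult)
  ultimately show False
    using assms(1) by simp
qed

lemma of_nat_neq_0_if_fact:
  assumes "of_nat (fact n) \<noteq> (0::'a::field)" "0 < m" "m \<le> n"
  shows "of_nat m \<noteq> (0::'a)"
proof -
  from assms(2) obtain j where m: "m = Suc j"
    by (cases m) auto
  have "of_nat (fact m) = of_nat m * (of_nat (fact j) :: 'a)"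
    unfolding m fact_Suc by (simp only: of_nat_mult of_nat_id)
  with fact_neq_0_mono[OF assms(1,3)] show ?thesis
    by auto
qed

lemma inj_on_of_nat_if_fact:
  assumes "of_nat (fact n) \<noteq> (0::'a::field)"
  shows "inj_on (of_nat :: nat \<Rightarrow> 'a) {..n}"
proof (rule linorder_inj_onI')
  fix x y :: nat assume xy: "x \<in> {..n}" "y \<in> {..n}" "x < y"
  then have "of_nat (y - x) \<noteq> (0::'a)"
    by (intro of_nat_neq_0_if_fact[OF assms]) auto
  moreover have "of_nat y = of_nat x + (of_nat (y - x) :: 'a)"
    using xy by (metis le_add_diff_inverse less_imp_le of_nat_add)
  ultimately show "of_nat x \<noteq> (of_nat y :: 'a)"
    by auto
qed

section \<open>Extracting a top coefficient from values on a box\<close>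

lemma monic_prod_linear_factors:
  fixes S :: "'a::field set"
  assumes "finite S"
  shows "degree (\<Prod>y\<in>S. [:- y, 1:]) = card S" and "coeff (\<Prod>y\<in>S. [:- y, 1:]) (card S) = 1"
proof -
  show deg: "degree (\<Prod>y\<in>S. [:- y, 1:]) = card S"
    by (subst degree_prod_sum_eq) simp_all
  have "lead_coeff (\<Prod>y\<in>S. [:- y, 1:]) = 1"
    by (subst lead_coeff_prod) simp
  then show "coeff (\<Prod>y\<in>S. [:- y, 1:]) (card S) = 1"
    by (simp only: deg)
qed

lemma poly_prod_linear_factors:
  "poly (\<Prod>y\<in>S. [:- y, 1:]) z = (\<Prod>y\<in>S. z - y :: 'a::field)"
  by (simp add: poly_prod)

text \<open>
  The weights of Lagrange interpolation: for \<open>deg f \<le> c\<close> the weighted sum of the values of \<open>f\<close> on \<open>B\<close> is the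
  coefficient of \<open>f\<close> at \<open>c\<close>. Products of such weights read off a top coefficient of a polynomial in
  several variables without any formal multivariate polynomial.
\<close>

lemma ex_leading_coeff_weights:
  fixes B :: "'a::field set"
  assumes "finite B" "card B = Suc c"
  shows "\<exists>w. \<forall>e\<le>c. (\<Sum>x\<in>B. w x * x ^ e) = (if e = c then 1 else 0)"
proof (intro exI allI impI)
  let ?L = "\<lambda>x. \<Prod>y\<in>B - {x}. [:- y, 1:]"
  let ?w = "\<lambda>x. 1 / (\<Prod>y\<in>B - {x}. x - y)"
  fix e assume "e \<le> c"
  have deg: "degree (?L x) = c" and lead: "coeff (?L x) c = 1" if "x \<in> B" for x
    using monic_prod_linear_factors[of "B - {x}"] that assms by simp_all
  define q where "q = (\<Sum>x\<in>B. smult (?w x * x ^ e) (?L x))"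
  have "q = monom 1 e"
  proof (rule poly_eqI_degree[of B])
    fix z assume "z \<in> B"
    have "poly q z = (\<Sum>x\<in>B. ?w x * x ^ e * (\<Prod>y\<in>B - {x}. z - y))"
      by (simp only: q_def poly_sum poly_smult poly_prod_linear_factors)
    also have "\<dots> = (\<Sum>x\<in>B. if x = z then z ^ e else 0)"
    proof (rule sum.cong[OF refl])
      fix x assume "x \<in> B"
      show "?w x * x ^ e * (\<Prod>y\<in>B - {x}. z - y) = (if x = z then z ^ e else 0)"
      proof (cases "x = z")
        case True
        have "(\<Prod>y\<in>B - {z}. z - y) \<noteq> 0"
          using assms by (auto simp: prod_zero_iff)
        with True show ?thesis by simp
      next
        case False
        then have "(\<Prod>y\<in>B - {x}. z - y) = 0"
          using assms \<open>z \<in> B\<close> by (intro prod_zero) auto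
        with False show ?thesis by simp
      qed
    qed
    also have "\<dots> = z ^ e"
      using assms \<open>z \<in> B\<close> by simp
    finally show "poly q z = poly (monom 1 e) z"
      by (simp add: poly_monom)
  next
    have "degree q \<le> c"
      unfolding q_def
    proof (rule degree_sum_le)
      fix x assume "x \<in> B"
      have "degree (smult (?w x * x ^ e) (?L x)) \<le> degree (?L x)"
        by (rule degree_smult_le)
      also have "\<dots> = c"
        by (rule deg[OF \<open>x \<in> B\<close>])
      finally show "degree (smult (?w x * x ^ e) (?L x)) \<le> c" .
    qed (fact assms)
    then show "degree q < card B" unfolding assms(2) by (rule le_imp_less_Suc)
    show "degree (monom (1::'a) e) < card B"
      unfolding degree_monom_eq[OF one_neq_zero] assms(2) using \<open>e \<le> c\<close> by (rule le_imp_less_Suc)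
  qed
  then have "(if e = c then 1 else 0) = coeff q c"
    by (simp only: coeff_monom)
  also have "\<dots> = (\<Sum>x\<in>B. ?w x * x ^ e)"
    unfolding q_def coeff_sum coeff_smult by (intro sum.cong refl) (simp only: lead mult_1_right)
  finally show "(\<Sum>x\<in>B. ?w x * x ^ e) = (if e = c then 1 else 0)" by simp
qed

text \<open>
  This is \<open>1 / (c - e)!\<close> with the usual convention that \<open>1 / m! = 0\<close> for negative \<open>m\<close>.
\<close>

definition inv_fact_diff :: "nat \<Rightarrow> nat \<Rightarrow> 'a::field" where
  "inv_fact_diff c e = (if e \<le> c then 1 / of_nat (fact (c - e)) else 0)"

lemma sum_PiE_insert:
  fixes f :: "_ \<Rightarrow> 'b::comm_monoid_add"
  assumes "a \<notin> I"
  shows "(\<Sum>x\<in>PiE (insert a I) B. f x) = (\<Sum>y\<in>B a. \<Sum>x\<in>PiE I B. f (x(a := y)))"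
proof -
  have "(\<Sum>x\<in>PiE (insert a I) B. f x) = (\<Sum>p\<in>B a \<times> PiE I B. f ((\<lambda>(y, x). x(a := y)) p))"
    unfolding PiE_insert_eq using assms
    by (subst sum.reindex) (auto intro: inj_combinator)
  then show ?thesis
    by (simp add: sum.cartesian_product case_prod_unfold)
qed

text \<open>
  The left-hand side reads off the coefficient at \<open>\<Prod> x\<^sub>i ^ c\<^sub>i\<close> of \<open>\<Prod> x\<^sub>i ^ e\<^sub>i (\<Sum> x\<^sub>i) ^ M\<close>. If the degree is too
  small it is zero; in the borderline case it is the multinomial coefficient
  \<open>M! / \<Prod> (c\<^sub>i - e\<^sub>i)!\<close>. Splitting off one variable by the binomial theorem, only one exponent of that
  variable survives: a smaller one is killed by its own weights, a larger one leaves too small a degree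
  for the other variables.
\<close>

lemma weighted_power_sum_moment:
  fixes w :: "'i \<Rightarrow> 'a::field \<Rightarrow> 'a"
  assumes "finite I"
    and "\<And>i. i \<in> I \<Longrightarrow> \<forall>q\<le>c i. (\<Sum>x\<in>B i. w i x * x ^ q) = (if q = c i then 1 else 0)"
    and "of_nat (fact M) \<noteq> (0::'a)" "M + sum e I \<le> sum c I"
  shows "(\<Sum>x\<in>PiE I B. (\<Prod>i\<in>I. w i (x i) * x i ^ e i) * (\<Sum>i\<in>I. x i) ^ M) =
         (if M + sum e I = sum c I then of_nat (fact M) * (\<Prod>i\<in>I. inv_fact_diff (c i) (e i)) else 0)"
  using assms
proof (induction I arbitrary: M rule: finite_induct)
  case empty
  then show ?case by simp
next
  case (insert a I)
  let ?F = "\<lambda>M. \<Sum>x\<in>PiE I B. (\<Prod>i\<in>I. w i (x i) * x i ^ e i) * (\<Sum>i\<in>I. x i) ^ M"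
  let ?m = "\<lambda>q. \<Sum>y\<in>B a. w a y * y ^ q"
  have upd: "(\<Prod>i\<in>I. w i ((x(a := y)) i) * (x(a := y)) i ^ e i) = (\<Prod>i\<in>I. w i (x i) * x i ^ e i)"
    "(\<Sum>i\<in>I. (x(a := y)) i) = (\<Sum>i\<in>I. x i)" for x y
    using insert.hyps(2) by (intro prod.cong sum.cong refl; auto)+
  have "(\<Sum>x\<in>PiE (insert a I) B. (\<Prod>i\<in>insert a I. w i (x i) * x i ^ e i) * (\<Sum>i\<in>insert a I. x i) ^ M)
      = (\<Sum>y\<in>B a. \<Sum>x\<in>PiE I B. w a y * y ^ e a * (\<Prod>i\<in>I. w i (x i) * x i ^ e i) * (y + (\<Sum>i\<in>I. x i)) ^ M)"
    unfolding sum_PiE_insert[OF insert.hyps(2)]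
    by (intro sum.cong refl, unfold sum.insert[OF insert.hyps] prod.insert[OF insert.hyps] upd) simp
  also have "\<dots> = (\<Sum>y\<in>B a. \<Sum>x\<in>PiE I B. \<Sum>b\<le>M.
      of_nat (M choose b) * (w a y * y ^ (e a + b)) *
        ((\<Prod>i\<in>I. w i (x i) * x i ^ e i) * (\<Sum>i\<in>I. x i) ^ (M - b)))"
    by (intro sum.cong refl) (simp add: binomial_ring sum_distrib_left power_add mult_ac)
  also have "\<dots> = (\<Sum>y\<in>B a. \<Sum>b\<le>M. \<Sum>x\<in>PiE I B.
      of_nat (M choose b) * (w a y * y ^ (e a + b)) *
        ((\<Prod>i\<in>I. w i (x i) * x i ^ e i) * (\<Sum>i\<in>I. x i) ^ (M - b)))"
    by (intro sum.cong refl, rule sum.swap)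
  also have "\<dots> = (\<Sum>b\<le>M. \<Sum>y\<in>B a. \<Sum>x\<in>PiE I B.
      of_nat (M choose b) * (w a y * y ^ (e a + b)) *
        ((\<Prod>i\<in>I. w i (x i) * x i ^ e i) * (\<Sum>i\<in>I. x i) ^ (M - b)))"
    by (rule sum.swap)
  also have "\<dots> = (\<Sum>b\<le>M. of_nat (M choose b) * ?m (e a + b) * ?F (M - b))"
    by (intro sum.cong refl) (simp add: sum_distrib_left[symmetric] sum_distrib_right[symmetric])
  also have "\<dots> = (\<Sum>b\<le>M. if b + e a = c a then of_nat (M choose b) * ?F (M - b) else 0)"
  proof (rule sum.cong[OF refl])
    fix b assume "b \<in> {..M}"
    have fb: "of_nat (fact (M - b)) \<noteq> (0::'a)"
      by (rule fact_neq_0_mono[OF insert.prems(2)]) simp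
    show "of_nat (M choose b) * ?m (e a + b) * ?F (M - b)
      = (if b + e a = c a then of_nat (M choose b) * ?F (M - b) else 0)"
    proof (cases "e a + b \<le> c a")
      case True
      with insert.prems(1)[of a] show ?thesis
        by (auto simp: add.commute)
    next
      case False
      then have "M - b + sum e I < sum c I"
        using insert.prems(3) insert.hyps \<open>b \<in> {..M}\<close> by simp
      then have "?F (M - b) = 0"
        using insert.IH[of "M - b"] insert.prems(1) fb by simp
      with False show ?thesis by simp
    qed
  qed
  also have "\<dots> = (\<Sum>b\<le>M. if b = c a - e a \<and> e a \<le> c a then of_nat (M choose b) * ?F (M - b) else 0)"
    by (rule sum.cong) (auto simp: )
  also have "\<dots> = (if M + sum e (insert a I) = sum c (insert a I)
      then of_nat (fact M) * (\<Prod>i\<in>insert a I. inv_fact_diff (c i) (e i)) else 0)" (is "?l = ?r")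
  proof (cases "e a \<le> c a \<and> c a - e a \<le> M")
    case True
    define b where "b = c a - e a"
    have fb: "of_nat (fact (M - b)) \<noteq> (0::'a)"
      by (rule fact_neq_0_mono[OF insert.prems(2)]) simp
    have "?l = of_nat (M choose b) * ?F (M - b)"
      using True by (simp add: b_def)
    also have "?F (M - b) = (if M - b + sum e I = sum c I
        then of_nat (fact (M - b)) * (\<Prod>i\<in>I. inv_fact_diff (c i) (e i)) else 0)"
      using True insert.prems insert.hyps fb by (intro insert.IH) (auto simp: b_def)
    also have "of_nat (M choose b) * \<dots> = ?r"
    proof -
      have "of_nat (M choose b) * of_nat (fact (M - b)) * of_nat (fact b) = (of_nat (fact M) :: 'a)"
        using binomial_fact_lemma[of b M] True
        by (metis b_def mult.commute mult.left_commute of_nat_mult)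
      moreover have fb0: "of_nat (fact b) \<noteq> (0::'a)"
        by (rule fact_neq_0_mono[OF insert.prems(2)]) (use True in \<open>simp add: b_def\<close>)
      ultimately have "of_nat (M choose b) * of_nat (fact (M - b)) = (of_nat (fact M) / of_nat (fact b) :: 'a)"
        by (simp only: nonzero_eq_divide_eq[OF fb0])
      also have "\<dots> = of_nat (fact M) * inv_fact_diff (c a) (e a)"
        using True by (simp add: inv_fact_diff_def b_def)
      finally have "of_nat (M choose b) * (of_nat (fact (M - b)) * (\<Prod>i\<in>I. inv_fact_diff (c i) (e i)))
          = of_nat (fact M) * (\<Prod>i\<in>insert a I. inv_fact_diff (c i) (e i) :: 'a)"
        by (simp only: prod.insert[OF insert.hyps] mult.assoc[symmetric])
      moreover have "M - b + sum e I = sum c I \<longleftrightarrow> M + sum e (insert a I) = sum c (insert a I)"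
        using True insert.hyps by (auto simp: b_def)
      ultimately show ?thesis
        by (simp only: if_distrib[of "(*) (of_nat (M choose b))"] mult_zero_right)
    qed
    finally show ?thesis .
  next
    case False
    then have l: "?l = 0"
      by (auto intro!: sum.neutral)
    have r: "?r = 0"
    proof (cases "M + sum e (insert a I) = sum c (insert a I) \<and> e a \<le> c a")
      case True
      with False insert.hyps have "sum c I < sum e I" by auto
      then obtain i where "i \<in> I" "c i < e i"
        by (meson not_le sum_mono)
      then show ?thesis
        using insert.hyps by (auto simp: inv_fact_diff_def intro!: prod_zero bexI[of _ i])
    next
      case False
      then show ?thesis
        using insert.hyps by (auto simp: inv_fact_diff_def)
    qed
    show ?thesis by (simp only: l r)
  qed
  finally show ?case .
qed

text \<open>
  The polynomial method in the form of the Combinatorial Nullstellensatz. The determinant plays the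
  part of the Vandermonde product: expanded over permutations it is a sum of monomials, so the
  previous lemma applies term by term, and it vanishes when two rows agree.
\<close>

theorem card_gt_if_nonsingular_sums_in:
  fixes B :: "nat \<Rightarrow> 'a::field set"
  assumes "finite X"
    and B: "\<And>i. i < h \<Longrightarrow> finite (B i) \<and> card (B i) = Suc (c i)"
    and deg: "N + (\<Sum>j<h. e j) = (\<Sum>i<h. c i)"
    and N: "of_nat (fact N) \<noteq> (0::'a)"
    and det: "det (mat h h (\<lambda>(i, j). inv_fact_diff (c i) (e j) :: 'a)) \<noteq> 0"
    and X: "\<And>x. x \<in> PiE {0..<h} B \<Longrightarrow> det (mat h h (\<lambda>(i, j). x i ^ e j)) \<noteq> 0 \<Longrightarrow> (\<Sum>i<h. x i) \<in> X"
  shows "N < card X"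
proof (rule ccontr)
  assume "\<not> N < card X"
  let ?I = "{0..<h}"
  have "\<forall>i\<in>?I. \<exists>v. \<forall>q\<le>c i. (\<Sum>x\<in>B i. v x * x ^ q) = (if q = c i then 1 else 0)"
    by (intro ballI ex_leading_coeff_weights) (simp_all add: B)
  from bchoice[OF this] obtain w where
    w: "\<And>i. i \<in> ?I \<Longrightarrow> \<forall>q\<le>c i. (\<Sum>x\<in>B i. w i x * x ^ q) = (if q = c i then 1 else 0)"
    by blast
  \<comment> \<open>the power of the variable brings the degree up to exactly \<open>N\<close>, even if \<open>X\<close> is smaller\<close>
  define Q where "Q = (\<Prod>y\<in>X. [:- y, 1:]) * monom 1 (N - card X)"
  let ?P = "\<Prod>y\<in>X. [:- y, 1:]" and ?m = "monom (1::'a) (N - card X)"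
  have deg_P: "degree ?P + degree ?m = N"
    using \<open>\<not> N < card X\<close> by (simp add: monic_prod_linear_factors(1)[OF \<open>finite X\<close>] degree_monom_eq)
  then have lead: "coeff Q N = 1"
    using coeff_mult_degree_sum[of ?P ?m] monic_prod_linear_factors[OF \<open>finite X\<close>]
    by (simp add: Q_def degree_monom_eq)
  have "degree Q \<le> N"
    using degree_mult_le[of ?P ?m] by (simp only: Q_def deg_P)
  with lead have "degree Q = N"
    by (intro antisym le_degree) auto
  define D where "D = (\<lambda>x :: nat \<Rightarrow> 'a. det (mat h h (\<lambda>(i, j). x i ^ e j)))"
  have D: "D x = (\<Sum>s | s permutes ?I. signof s * (\<Prod>i\<in>?I. x i ^ e (s i)))" for x
    unfolding D_def
    by (subst det_def'[of _ h]) (auto intro!: sum.cong prod.cong dest: permutes_in_image)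
  define S where "S = (\<lambda>x :: nat \<Rightarrow> 'a. \<Sum>i\<in>?I. x i)"
  have "poly Q (S x) * D x = 0" if "x \<in> PiE ?I B" for x
  proof (cases "D x = 0")
    case False
    then have "S x \<in> X"
      using X[OF that] by (simp add: D_def S_def atLeast0LessThan)
    then have "poly Q (S x) = 0"
      using \<open>finite X\<close> by (auto simp: Q_def poly_prod intro!: prod_zero)
    then show ?thesis by simp
  qed simp
  then have "0 = (\<Sum>x\<in>PiE ?I B. (\<Prod>i\<in>?I. w i (x i)) * (poly Q (S x) * D x))"
    by (simp add: sum.neutral)
  also have "\<dots> = (\<Sum>x\<in>PiE ?I B. \<Sum>M\<le>N. \<Sum>s | s permutes ?I.
      coeff Q M * signof s * ((\<Prod>i\<in>?I. w i (x i) * x i ^ e (s i)) * S x ^ M))"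
    unfolding poly_altdef \<open>degree Q = N\<close> D sum_product
    unfolding sum_distrib_left
    by (intro sum.cong refl) (simp add: prod.distrib mult_ac)
  also have "\<dots> = (\<Sum>M\<le>N. \<Sum>x\<in>PiE ?I B. \<Sum>s | s permutes ?I.
      coeff Q M * signof s * ((\<Prod>i\<in>?I. w i (x i) * x i ^ e (s i)) * S x ^ M))"
    by (rule sum.swap)
  also have "\<dots> = (\<Sum>M\<le>N. \<Sum>s | s permutes ?I. \<Sum>x\<in>PiE ?I B.
      coeff Q M * signof s * ((\<Prod>i\<in>?I. w i (x i) * x i ^ e (s i)) * S x ^ M))"
    by (intro sum.cong refl, rule sum.swap)
  also have "\<dots> = (\<Sum>M\<le>N. \<Sum>s | s permutes ?I. coeff Q M * signof s *
      (if M = N then of_nat (fact N) * (\<Prod>i\<in>?I. inv_fact_diff (c i) (e (s i))) else 0))"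
  proof (intro sum.cong refl)
    fix M s assume "M \<in> {..N}" "s \<in> {s. s permutes ?I}"
    have e: "(\<Sum>i<h. e (s i)) = (\<Sum>i<h. e i)"
      using \<open>s \<in> _\<close> by (auto simp: sum.permute[of s "{..<h}" e] o_def atLeast0LessThan)
    have "of_nat (fact M) \<noteq> (0::'a)"
      by (rule fact_neq_0_mono[OF N]) (use \<open>M \<in> {..N}\<close> in simp)
    then have "(\<Sum>x\<in>PiE ?I B. (\<Prod>i\<in>?I. w i (x i) * x i ^ e (s i)) * S x ^ M) =
        (if M + (\<Sum>i\<in>?I. e (s i)) = sum c ?I
          then of_nat (fact M) * (\<Prod>i\<in>?I. inv_fact_diff (c i) (e (s i))) else 0)"
      unfolding S_def using w deg \<open>M \<in> {..N}\<close>
      by (intro weighted_power_sum_moment) (auto simp: e atLeast0LessThan)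
    also have "\<dots> = (if M = N then of_nat (fact N) * (\<Prod>i\<in>?I. inv_fact_diff (c i) (e (s i))) else 0)"
      using deg by (auto simp: e atLeast0LessThan)
    finally show "(\<Sum>x\<in>PiE ?I B. coeff Q M * signof s * ((\<Prod>i\<in>?I. w i (x i) * x i ^ e (s i)) * S x ^ M))
      = coeff Q M * signof s * (if M = N then of_nat (fact N) * (\<Prod>i\<in>?I. inv_fact_diff (c i) (e (s i))) else 0)"
      by (simp add: sum_distrib_left[symmetric])
  qed
  also have "\<dots> = (\<Sum>M\<le>N. if M = N then \<Sum>s | s permutes ?I. signof s *
      (of_nat (fact N) * (\<Prod>i\<in>?I. inv_fact_diff (c i) (e (s i)))) else 0)"
    by (intro sum.cong refl) (auto simp: lead)
  also have "\<dots> = of_nat (fact N) * det (mat h h (\<lambda>(i, j). inv_fact_diff (c i) (e j) :: 'a))"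
    by (subst det_def'[of _ h])
      (auto simp: sum_distrib_left mult_ac intro!: sum.cong prod.cong dest: permutes_in_image)
  finally show False
    using N det by simp
qed

corollary card_gt_if_nonsingular_sums_of_subset_in:
  fixes U :: "'a::field set"
  assumes "finite X" "finite U" "\<And>i. i < h \<Longrightarrow> c i < card U"
    and "N + (\<Sum>j<h. e j) = (\<Sum>i<h. c i)" "of_nat (fact N) \<noteq> (0::'a)"
    and "det (mat h h (\<lambda>(i, j). inv_fact_diff (c i) (e j) :: 'a)) \<noteq> 0"
    and X: "\<And>x. (\<And>i. i < h \<Longrightarrow> x i \<in> U) \<Longrightarrow> det (mat h h (\<lambda>(i, j). x i ^ e j)) \<noteq> 0 \<Longrightarrow>
      (\<Sum>i<h. x i) \<in> X"
  shows "N < card X"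
proof -
  have "\<forall>i\<in>{..<h}. \<exists>B. B \<subseteq> U \<and> card B = Suc (c i)"
    using assms(3) obtain_subset_with_card_n by (metis Suc_leI lessThan_iff)
  from bchoice[OF this] obtain B where B: "\<And>i. i < h \<Longrightarrow> B i \<subseteq> U \<and> card (B i) = Suc (c i)"
    by auto
  show ?thesis
  proof (rule card_gt_if_nonsingular_sums_in[OF \<open>finite X\<close> _ assms(4-6)])
    show "finite (B i) \<and> card (B i) = Suc (c i)" if "i < h" for i
      using B[OF that] \<open>finite U\<close> finite_subset by blast
    show "(\<Sum>i<h. x i) \<in> X"
      if x: "x \<in> PiE {0..<h} B" and "det (mat h h (\<lambda>(i, j). x i ^ e j)) \<noteq> 0" for x
    proof (rule X[OF _ that(2)])
      fix i assume "i < h"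
      then show "x i \<in> U"
        using B PiE_mem[OF x, of i] by auto
    qed
  qed
qed

section \<open>Nonvanishing of the determinants\<close>

definition falling_factorial_poly :: "nat \<Rightarrow> 'a::field poly" where
  "falling_factorial_poly i = (\<Prod>t<i. [:- of_nat t, 1:])"

lemma falling_factorial_poly_Suc:
  "falling_factorial_poly (Suc i) = falling_factorial_poly i * [:- of_nat i, 1:]"
  by (simp add: falling_factorial_poly_def mult.commute)

lemma degree_falling_factorial_poly: "degree (falling_factorial_poly i) = i"
  unfolding falling_factorial_poly_def by (subst degree_prod_sum_eq) simp_all

lemma coeff_falling_factorial_poly_top: "coeff (falling_factorial_poly i) i = 1"
proof -
  have "lead_coeff (falling_factorial_poly i :: 'a poly) = 1"
    unfolding falling_factorial_poly_def by (subst lead_coeff_prod) simp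
  then show ?thesis
    by (simp only: degree_falling_factorial_poly)
qed

lemma poly_falling_factorial_poly_of_nat:
  "i \<le> l \<Longrightarrow> poly (falling_factorial_poly i) (of_nat l) * of_nat (fact (l - i)) = (of_nat (fact l) :: 'a::field)"
proof (induction i)
  case 0
  then show ?case by (simp add: falling_factorial_poly_def)
next
  case (Suc i)
  have "fact (l - i) = (l - i) * fact (l - Suc i)"
    using Suc.prems by (metis Suc_diff_Suc Suc_le_lessD fact_Suc of_nat_id)
  then have "of_nat (fact (l - i)) = (of_nat l - of_nat i) * (of_nat (fact (l - Suc i)) :: 'a)"
    using Suc.prems by (simp only: of_nat_mult of_nat_diff[OF Suc_leD])
  moreover have "poly [:- of_nat i, 1:] (of_nat l) = (of_nat l - of_nat i :: 'a)"
    by simp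
  ultimately show ?case
    using Suc.IH[OF Suc_leD[OF Suc.prems]]
    by (simp only: falling_factorial_poly_Suc poly_mult mult_ac)
qed

text \<open>
  This turns \<open>1 / (l - i)!\<close> into a polynomial in \<open>l\<close>, up to a factor that depends on \<open>l\<close> alone.
\<close>

lemma poly_falling_factorial_poly_eq_inv_fact_diff:
  assumes "of_nat (fact l) \<noteq> (0::'a::field)"
  shows "poly (falling_factorial_poly i) (of_nat l) = of_nat (fact l) * (inv_fact_diff l i :: 'a)"
proof (cases "i \<le> l")
  case True
  have "of_nat (fact (l - i)) \<noteq> (0::'a)"
    by (rule fact_neq_0_mono[OF assms]) simp
  from nonzero_eq_divide_eq[OF this] show ?thesis
    using poly_falling_factorial_poly_of_nat[OF True, where 'a='a] True
    by (simp add: inv_fact_diff_def)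
next
  case False
  then have "poly (falling_factorial_poly i) (of_nat l) = (0::'a)"
    unfolding falling_factorial_poly_def poly_prod by (intro prod_zero) (auto intro!: bexI[of _ l])
  with False show ?thesis
    by (simp add: inv_fact_diff_def)
qed

text \<open>
  Scaling row \<open>j\<close> by \<open>(l j)!\<close> turns a kernel vector into the coefficients of a combination of falling
  factorials that vanishes at all the points \<open>l j\<close>.
\<close>

lemma det_inv_fact_diff_neq_0:
  fixes l s :: "nat \<Rightarrow> nat"
  assumes fact_l: "\<And>j. j < h \<Longrightarrow> of_nat (fact (l j)) \<noteq> (0::'a::field)"
    and indep: "\<And>v. (\<And>j. j < h \<Longrightarrow>
        poly (\<Sum>i<h. smult (v i) (falling_factorial_poly (s i))) (of_nat (l j)) = (0::'a)) \<Longrightarrow>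
        (\<And>i. i < h \<Longrightarrow> v i = 0)"
  shows "det (mat h h (\<lambda>(j, i). inv_fact_diff (l j) (s i) :: 'a)) \<noteq> 0"
proof
  let ?A = "mat h h (\<lambda>(j, i). inv_fact_diff (l j) (s i) :: 'a)"
  assume "det ?A = 0"
  then obtain v where v: "v \<in> carrier_vec h" "v \<noteq> 0\<^sub>v h" "?A *\<^sub>v v = 0\<^sub>v h"
    using det_0_iff_vec_prod_zero[of ?A h] by auto
  have "v $ i = 0" if "i < h" for i
  proof (rule indep[OF _ that])
    fix j assume "j < h"
    then have "0 = (?A *\<^sub>v v) $ j"
      using v(3) by simp
    also have "\<dots> = (\<Sum>i<h. inv_fact_diff (l j) (s i) * v $ i)"
      using v(1) \<open>j < h\<close> by (simp add: scalar_prod_def atLeast0LessThan)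
    finally have "(\<Sum>i<h. inv_fact_diff (l j) (s i) * v $ i) = 0" ..
    moreover have "poly (\<Sum>i<h. smult (v $ i) (falling_factorial_poly (s i))) (of_nat (l j))
        = of_nat (fact (l j)) * (\<Sum>i<h. inv_fact_diff (l j) (s i) * v $ i)"
      unfolding poly_sum poly_smult poly_falling_factorial_poly_eq_inv_fact_diff[OF fact_l[OF \<open>j < h\<close>]]
      by (simp only: sum_distrib_left mult_ac)
    ultimately show "poly (\<Sum>i<h. smult (v $ i) (falling_factorial_poly (s i))) (of_nat (l j)) = 0"
      by simp
  qed
  then have "v = 0\<^sub>v h"
    using v(1) by (intro eq_vecI) auto
  with v(2) show False by contradiction
qed

lemma falling_factorial_polys_independent:
  assumes "(\<Sum>i<n. smult (v i) (falling_factorial_poly i)) = (0 :: 'a::field poly)" "i < n"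
  shows "v i = 0"
  using assms
proof (induction n)
  case (Suc n)
  have "coeff (\<Sum>i<n. smult (v i) (falling_factorial_poly i)) n = 0"
    by (simp add: coeff_sum degree_falling_factorial_poly coeff_eq_0)
  then have "coeff (\<Sum>i<Suc n. smult (v i) (falling_factorial_poly i)) n = v n"
    by (simp add: coeff_falling_factorial_poly_top)
  then have "v n = 0"
    by (simp only: Suc.prems(1) coeff_0)
  with Suc show ?case
    by (auto simp: less_Suc_eq)
qed simp

text \<open>
  A combination of the first \<open>h\<close> falling factorials has degree below \<open>h\<close>, so \<open>h\<close> roots are too many. The
  condition on \<open>m\<close> keeps the points distinct in the field.
\<close>

lemma falling_factorial_coeffs_eq_0_if_roots:
  fixes v :: "nat \<Rightarrow> 'a::field"
  assumes roots: "\<And>j. j < h \<Longrightarrow> poly (\<Sum>i<h. smult (v i) (falling_factorial_poly i)) (of_nat (l j)) = 0"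
    and m: "of_nat (fact m) \<noteq> (0::'a)" "\<And>j. j < h \<Longrightarrow> l j \<le> m"
    and inj: "inj_on l {..<h}" and "i < h"
  shows "v i = 0"
proof (rule falling_factorial_polys_independent[OF _ \<open>i < h\<close>])
  let ?f = "\<Sum>i<h. smult (v i) (falling_factorial_poly i)"
  let ?Z = "(\<lambda>j. of_nat (l j) :: 'a) ` {..<h}"
  have "inj_on (of_nat \<circ> l :: nat \<Rightarrow> 'a) {..<h}"
    using m(2) by (intro comp_inj_on inj inj_on_subset[OF inj_on_of_nat_if_fact[OF m(1)]]) auto
  then have card_Z: "card ?Z = h"
    by (simp add: card_image o_def)
  have "degree ?f \<le> h - 1"
    by (intro degree_sum_le)
      (auto intro!: order.trans[OF degree_smult_le] simp: degree_falling_factorial_poly)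
  then show "?f = 0"
    using \<open>i < h\<close> by (intro poly_eqI_degree[of ?Z]) (auto simp: card_Z roots)
qed

text \<open>
  The numbers \<open>b i = (2 e - i)! / (2 ^ (e - i) (e - i)! i!)\<close> are the coefficients of a Bessel polynomial.
  The step from \<open>e\<close> to \<open>e + 1\<close> multiplies by \<open>u - (2 e + 1) = (u - i) - (2 e + 1 - i)\<close>, so that
  \<open>b' i = b (i - 1) + (2 e + 1 - i) b i\<close>. What matters later is that every prime divisor of \<open>b i\<close> is at most
  \<open>2 e - i\<close>.
\<close>

lemma prod_odd_linear_factors_in_falling_factorials:
  "\<exists>b :: nat \<Rightarrow> nat.
     (\<Prod>j<e. [:- of_nat (2 * j + 1), 1:]) =
       (\<Sum>i\<le>e. smult ((- 1) ^ (e - i) * of_nat (b i)) (falling_factorial_poly i :: 'a::field poly)) \<and>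
     (\<forall>i\<le>e. b i * (2 ^ (e - i) * fact (e - i) * fact i) = fact (2 * e - i))"
proof (induction e)
  case 0
  show ?case
    by (rule exI[of _ "\<lambda>_. 1"]) (simp add: falling_factorial_poly_def)
next
  case (Suc e)
  then obtain b :: "nat \<Rightarrow> nat" where
    b: "(\<Prod>j<e. [:- of_nat (2 * j + 1), 1:]) =
       (\<Sum>i\<le>e. smult ((- 1) ^ (e - i) * of_nat (b i)) (falling_factorial_poly i :: 'a poly))"
    and fact_b: "\<And>i. i \<le> e \<Longrightarrow> b i * (2 ^ (e - i) * fact (e - i) * fact i) = fact (2 * e - i)"
    by blast
  define b1 where "b1 i = (if i = 0 then 0 else b (i - 1))" for i
  define b2 where "b2 i = (if i \<le> e then (2 * e + 1 - i) * b i else 0)" for i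
  let ?c = "\<lambda>i. (- 1) ^ (e - i) * of_nat (b i) :: 'a"
  let ?c' = "\<lambda>i. (- 1) ^ (Suc e - i) :: 'a"
  have split: "falling_factorial_poly i * [:- of_nat (2 * e + 1), 1:] =
      falling_factorial_poly (Suc i) - smult (of_nat (2 * e + 1 - i)) (falling_factorial_poly i :: 'a poly)"
    if "i \<le> e" for i
  proof -
    have "[:- of_nat (2 * e + 1), 1:] = [:- of_nat i, 1:] - [:of_nat (2 * e + 1 - i) :: 'a:]"
      using that by (simp add: of_nat_diff)
    then show ?thesis
      unfolding falling_factorial_poly_Suc by (simp only: right_diff_distrib) simp
  qed
  have "(\<Prod>j<Suc e. [:- of_nat (2 * j + 1), 1:]) =
      (\<Sum>i\<le>e. smult (?c i) (falling_factorial_poly i * [:- of_nat (2 * e + 1), 1:]))"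
    unfolding prod.lessThan_Suc b sum_distrib_right by (simp only: mult_smult_left)
  also have "\<dots> = (\<Sum>i\<le>e. smult (?c i) (falling_factorial_poly (Suc i)))
      - (\<Sum>i\<le>e. smult (?c i * of_nat (2 * e + 1 - i)) (falling_factorial_poly i))"
    unfolding sum_subtractf[symmetric]
    by (intro sum.cong refl) (simp only: split atMost_iff smult_diff_right smult_smult)
  also have "(\<Sum>i\<le>e. smult (?c i) (falling_factorial_poly (Suc i)))
      = (\<Sum>i\<le>Suc e. smult (?c' i * of_nat (b1 i)) (falling_factorial_poly i))"
    by (subst sum.atMost_Suc_shift) (simp add: b1_def)
  also have "(\<Sum>i\<le>e. smult (?c i * of_nat (2 * e + 1 - i)) (falling_factorial_poly i))
      = (\<Sum>i\<le>e. - smult (?c' i * of_nat (b2 i)) (falling_factorial_poly i))"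
  proof (rule sum.cong[OF refl])
    fix i assume "i \<in> {..e}"
    then have "b2 i = (2 * e + 1 - i) * b i" "Suc e - i = Suc (e - i)"
      by (simp_all add: b2_def Suc_diff_le)
    then have "?c i * of_nat (2 * e + 1 - i) = - (?c' i * of_nat (b2 i))"
      by (simp only: of_nat_mult power_Suc mult_minus_left mult_minus_right mult_1_left minus_minus mult_ac)
    then show "smult (?c i * of_nat (2 * e + 1 - i)) (falling_factorial_poly i)
        = - smult (?c' i * of_nat (b2 i)) (falling_factorial_poly i)"
      by (simp only: smult_minus_left)
  qed
  also have "\<dots> = - (\<Sum>i\<le>Suc e. smult (?c' i * of_nat (b2 i)) (falling_factorial_poly i))"
  proof -
    have "b2 (Suc e) = 0"
      by (simp add: b2_def)
    then show ?thesis
      by (simp only: sum_negf sum.atMost_Suc of_nat_0 mult_zero_right smult_0_left add_0_right)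
  qed
  also have "(\<Sum>i\<le>Suc e. smult (?c' i * of_nat (b1 i)) (falling_factorial_poly i)) -
      - (\<Sum>i\<le>Suc e. smult (?c' i * of_nat (b2 i)) (falling_factorial_poly i))
    = (\<Sum>i\<le>Suc e. smult (?c' i * of_nat (b1 i + b2 i)) (falling_factorial_poly i))"
    unfolding diff_minus_eq_add sum.distrib[symmetric]
    by (simp only: of_nat_add distrib_left smult_add_left)
  finally have "(\<Prod>j<Suc e. [:- of_nat (2 * j + 1), 1:]) = \<dots>" .
  moreover have "(b1 i + b2 i) * (2 ^ (Suc e - i) * fact (Suc e - i) * fact i) = fact (2 * Suc e - i)"
    if "i \<le> Suc e" for i
  proof -
    have 1: "b1 i * (2 ^ (Suc e - i) * fact (Suc e - i) * fact i) = i * fact (2 * e + 1 - i)"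
    proof (cases i)
      case (Suc i')
      then show ?thesis
        using fact_b[of i', symmetric] that by (simp add: b1_def mult_ac del: mult_Suc mult_Suc_right)
    qed (simp add: b1_def)
    have 2: "b2 i * (2 ^ (Suc e - i) * fact (Suc e - i) * fact i) = 2 * (e + 1 - i) * fact (2 * e + 1 - i)"
    proof (cases "i \<le> e")
      case True
      then have "fact (2 * e + 1 - i) = (2 * e + 1 - i) * (fact (2 * e - i) :: nat)"
        by (simp add: Suc_diff_le)
      then show ?thesis
        using fact_b[OF True, symmetric] True
        by (simp add: b2_def Suc_diff_le mult_ac del: mult_Suc mult_Suc_right)
    qed (use that in \<open>simp add: b2_def\<close>)
    have "2 * Suc e - i = Suc (2 * e + 1 - i)"
      using that by simp
    then have "fact (2 * Suc e - i) = (2 * e + 2 - i) * (fact (2 * e + 1 - i) :: nat)"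
      using that by (simp only: fact_Suc of_nat_id) simp
    also have "2 * e + 2 - i = i + 2 * (e + 1 - i)"
      using that by simp
    finally show ?thesis
      by (simp only: add_mult_distrib 1 2)
  qed
  ultimately show ?case
    by (intro exI[of _ "\<lambda>i. b1 i + b2 i"]) blast
qed

text \<open>
  Leaving out the falling factorial of index \<open>r\<close>, the degree may be \<open>e\<close> and \<open>e\<close> roots no longer suffice by
  counting. But a polynomial of degree at most \<open>e\<close> with the roots \<open>1, 3, \<dots>, 2 e - 1\<close> is a multiple of the
  product of the corresponding linear factors, and the coefficient of that product at \<open>r\<close> is nonzero
  whereas the given combination has none there.
\<close>

lemma falling_factorial_coeffs_with_gap_eq_0_if_odd_roots:
  fixes v :: "nat \<Rightarrow> 'a::field"
  assumes roots: "\<And>j. j < e \<Longrightarrow>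
      poly (\<Sum>i<e. smult (v i) (falling_factorial_poly (if i < r then i else Suc i))) (of_nat (2 * j + 1)) = 0"
    and r: "0 < r" "r \<le> e" and m: "of_nat (fact (2 * e - 1)) \<noteq> (0::'a)" and "i < e"
  shows "v i = 0"
proof -
  let ?s = "\<lambda>i. if i < r then i else Suc i"
  let ?f = "\<Sum>i<e. smult (v i) (falling_factorial_poly (?s i))"
  define u where "u i = (if i < r then v i else if i = r then 0 else v (i - 1))" for i
  have "bij_betw ?s {..<e} ({..e} - {r})"
    by (rule bij_betw_byWitness[where f' = "\<lambda>i. if i < r then i else i - 1"]) (use r in auto)
  note sum.reindex_bij_betw[OF this, of "\<lambda>i. smult (u i) (falling_factorial_poly i)", symmetric]
  moreover have u_s: "u (?s i) = v i" for i
    by (simp add: u_def)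
  ultimately have "?f = (\<Sum>i\<in>{..e} - {r}. smult (u i) (falling_factorial_poly i))"
    by simp
  also have "\<dots> = (\<Sum>i\<le>e. smult (u i) (falling_factorial_poly i))"
    by (intro sum.mono_neutral_left) (auto simp: u_def)
  finally have f: "?f = \<dots>" .
  obtain b :: "nat \<Rightarrow> nat" where
    b: "(\<Prod>j<e. [:- of_nat (2 * j + 1), 1:]) =
       (\<Sum>i\<le>e. smult ((- 1) ^ (e - i) * of_nat (b i)) (falling_factorial_poly i :: 'a poly))"
    and fact_b: "\<And>i. i \<le> e \<Longrightarrow> b i * (2 ^ (e - i) * fact (e - i) * fact i) = fact (2 * e - i)"
    using prod_odd_linear_factors_in_falling_factorials[of e, where 'a='a] by blast
  define c where "c i = (- 1) ^ (e - i) * (of_nat (b i) :: 'a)" for i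
  have "b e = 1"
    using fact_b[of e] by simp
  then have "c e = 1"
    by (simp add: c_def)
  \<comment> \<open>subtracting the multiple of the product with the same top coefficient leaves degree below \<open>e\<close>\<close>
  have u: "u i - u e * c i = 0" if "i < e" for i
  proof (rule falling_factorial_coeffs_eq_0_if_roots[where l = "\<lambda>j. 2 * j + 1" and h = e, OF _ m _ _ that])
    fix j assume "j < e"
    have "(\<Sum>i<e. smult (u i - u e * c i) (falling_factorial_poly i))
        = (\<Sum>i\<le>e. smult (u i - u e * c i) (falling_factorial_poly i))"
      by (simp add: lessThan_Suc_atMost[symmetric] \<open>c e = 1\<close>)
    also have "\<dots> = ?f - smult (u e) (\<Prod>j<e. [:- of_nat (2 * j + 1), 1:])"
      unfolding f b c_def[symmetric]
      by (rule poly_eqI) (simp add: coeff_sum sum_distrib_left sum_subtractf left_diff_distrib mult.assoc)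
    finally have "poly (\<Sum>i<e. smult (u i - u e * c i) (falling_factorial_poly i)) (of_nat (2 * j + 1))
      = poly ?f (of_nat (2 * j + 1)) - u e * (\<Prod>t<e. of_nat (2 * j + 1) - of_nat (2 * t + 1))"
      by (simp add: poly_prod)
    also have "(\<Prod>t<e. of_nat (2 * j + 1) - of_nat (2 * t + 1)) = (0::'a)"
      using \<open>j < e\<close> by (intro prod_zero) auto
    finally show "poly (\<Sum>i<e. smult (u i - u e * c i) (falling_factorial_poly i)) (of_nat (2 * j + 1)) = 0"
      using roots[OF \<open>j < e\<close>] by simp
  qed (auto simp: inj_on_def)
  have "u e * c r = 0"
  proof (cases "r = e")
    case False
    with u[of r] r show ?thesis by (simp add: u_def)
  qed (simp add: u_def)
  moreover have "c r \<noteq> 0"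
  proof -
    have "of_nat (b r * (2 ^ (e - r) * fact (e - r) * fact r)) \<noteq> (0::'a)"
      unfolding fact_b[OF r(2)] by (rule fact_neq_0_mono[OF m]) (use r in auto)
    then have "of_nat (b r) \<noteq> (0::'a)"
      by (metis mult_zero_left of_nat_mult)
    then show ?thesis
      by (simp add: c_def)
  qed
  ultimately have "u e = 0"
    by simp
  then have "u i = 0" if "i \<le> e" for i
    using u[of i] that by (cases "i = e") auto
  then have "u (?s i) = 0"
    using \<open>i < e\<close> by auto
  then show ?thesis
    by (simp only: u_s)
qed

section \<open>Signed sumsets\<close>

lemma restricted_signed_sumset_eq:
  assumes "finite A"
  shows "restricted_signed_sumset h A =
    {\<Sum>P - \<Sum>Q | P Q. P \<subseteq> A \<and> Q \<subseteq> A \<and> P \<inter> Q = {} \<and> card P + card Q = h}"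
proof (intro equalityI subsetI)
  fix y assume "y \<in> restricted_signed_sumset h A"
  then obtain c where c: "\<And>a. a \<in> A \<Longrightarrow> c a \<in> {-1, 0, 1}" "(\<Sum>a\<in>A. \<bar>c a\<bar>) = int h"
    and y: "y = (\<Sum>a\<in>A. of_int (c a) * a)"
    unfolding restricted_signed_sumset_def by auto
  let ?P = "{a \<in> A. c a = 1}" and ?Q = "{a \<in> A. c a = - 1}"
  have "y = (\<Sum>a\<in>A. (if c a = 1 then a else 0) - (if c a = - 1 then a else 0))"
    unfolding y by (intro sum.cong refl) (use c(1) in force)
  also have "\<dots> = \<Sum>?P - \<Sum>?Q"
    using assms by (simp add: sum_subtractf sum.inter_filter)
  finally have "y = \<Sum>?P - \<Sum>?Q" .
  moreover have "int h = (\<Sum>a\<in>A. (if c a = 1 then 1 else 0) + (if c a = - 1 then 1 else 0))"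
    unfolding c(2)[symmetric] by (intro sum.cong refl) (use c(1) in force)
  then have "card ?P + card ?Q = h"
    using assms by (simp add: sum.distrib sum.inter_filter[symmetric])
  ultimately show "y \<in> {\<Sum>P - \<Sum>Q | P Q. P \<subseteq> A \<and> Q \<subseteq> A \<and> P \<inter> Q = {} \<and> card P + card Q = h}"
    by (intro CollectI exI[of _ ?P] exI[of _ ?Q]) auto
next
  fix y assume "y \<in> {\<Sum>P - \<Sum>Q | P Q. P \<subseteq> A \<and> Q \<subseteq> A \<and> P \<inter> Q = {} \<and> card P + card Q = h}"
  then obtain P Q where PQ: "P \<subseteq> A" "Q \<subseteq> A" "P \<inter> Q = {}" "card P + card Q = h"
    and y: "y = \<Sum>P - \<Sum>Q"
    by blast
  have fin: "finite P" "finite Q"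
    using PQ assms finite_subset by auto
  define c :: "'a \<Rightarrow> int" where "c a = (if a \<in> P then 1 else if a \<in> Q then - 1 else 0)" for a
  have "(\<Sum>a\<in>A. of_int (c a) * a) = (\<Sum>a\<in>A. (if a \<in> P then a else 0) - (if a \<in> Q then a else 0))"
    by (intro sum.cong refl) (use PQ(3) in \<open>auto simp: c_def\<close>)
  also have "\<dots> = y"
    using assms PQ by (simp add: y sum_subtractf sum.inter_restrict[symmetric] Int_absorb1)
  finally have "y = (\<Sum>a\<in>A. of_int (c a) * a)" ..
  moreover have "(\<Sum>a\<in>A. \<bar>c a\<bar>) = (\<Sum>a\<in>A. (if a \<in> P then 1 else 0) + (if a \<in> Q then 1 else 0))"
    by (intro sum.cong refl) (use PQ(3) in \<open>auto simp: c_def\<close>)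
  then have "(\<Sum>a\<in>A. \<bar>c a\<bar>) = int h"
    using assms PQ by (auto simp: sum.distrib sum.inter_restrict[symmetric] Int_absorb1)
  ultimately show "y \<in> restricted_signed_sumset h A"
    unfolding restricted_signed_sumset_def
    by (intro CollectI exI[of _ c] conjI ballI) (simp_all add: c_def)
qed

lemma finite_restricted_signed_sumset:
  assumes "finite A"
  shows "finite (restricted_signed_sumset h A)"
proof (rule finite_subset)
  show "restricted_signed_sumset h A \<subseteq> (\<lambda>(P, Q). \<Sum>P - \<Sum>Q) ` (Pow A \<times> Pow A)"
    unfolding restricted_signed_sumset_eq[OF assms] by auto
qed (use assms in simp)

lemma restricted_signed_sumset_neq_empty:
  assumes "finite A" "h \<le> card A"
  shows "restricted_signed_sumset h A \<noteq> {}"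
proof -
  obtain P where "P \<subseteq> A" "card P = h"
    using obtain_subset_with_card_n[OF assms(2)] by blast
  then have "\<Sum>P - \<Sum>{} \<in> restricted_signed_sumset h A"
    unfolding restricted_signed_sumset_eq[OF assms(1)]
    by (intro CollectI exI[of _ P] exI[of _ "{}"]) auto
  then show ?thesis by blast
qed

lemma card_restricted_signed_sumset_gt_0:
  "finite A \<Longrightarrow> h \<le> card A \<Longrightarrow> 0 < card (restricted_signed_sumset h A)"
  by (simp add: card_gt_0_iff finite_restricted_signed_sumset restricted_signed_sumset_neq_empty)

lemma sum_in_restricted_signed_sumset:
  assumes "finite A" and x: "\<And>i. i < h \<Longrightarrow> x i \<in> A" "inj_on x {..<h}"
  shows "(\<Sum>i<h. x i) \<in> restricted_signed_sumset h A"
proof -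
  have "(\<Sum>i<h. x i) = \<Sum>(x ` {..<h}) - \<Sum>{}"
    using x(2) by (simp add: sum.reindex)
  moreover have "card (x ` {..<h}) = h"
    using x(2) by (simp add: card_image)
  ultimately show ?thesis
    unfolding restricted_signed_sumset_eq[OF assms(1)]
    by (intro CollectI exI[of _ "x ` {..<h}"] exI[of _ "{}"]) (use x(1) in auto)
qed

text \<open>
  Distinct squares guarantee that no two of the chosen elements belong to the same \<open>a \<in> A\<close>, not even
  with opposite signs.
\<close>

lemma sum_signed_in_restricted_signed_sumset:
  fixes A :: "'a::field set"
  assumes "finite A" and x: "\<And>i. i < h \<Longrightarrow> x i \<in> A \<union> uminus ` A"
    and inj: "inj_on (\<lambda>i. (x i)\<^sup>2) {..<h}"
  shows "(\<Sum>i<h. x i) \<in> restricted_signed_sumset h A"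
proof -
  let ?I = "{i. i < h \<and> x i \<in> A}" and ?J = "{i. i < h \<and> x i \<notin> A}"
  let ?P = "x ` ?I" and ?Q = "(\<lambda>i. - x i) ` ?J"
  have eq: "i = j" if "i < h" "j < h" "(x i)\<^sup>2 = (x j)\<^sup>2" for i j
    using inj_onD[OF inj that(3)] that by simp
  have inj_P: "inj_on x ?I" and inj_Q: "inj_on (\<lambda>i. - x i) ?J"
    by (auto intro!: inj_onI eq)
  have IJ: "{..<h} = ?I \<union> ?J" "?I \<inter> ?J = {}"
    by auto
  have "(\<Sum>i<h. x i) = (\<Sum>i\<in>?I. x i) + (\<Sum>i\<in>?J. x i)"
    by (subst IJ(1), rule sum.union_disjoint) auto
  also have "\<dots> = \<Sum>?P - \<Sum>?Q"
    using inj_P inj_Q by (simp add: sum.reindex sum_negf)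
  finally have "(\<Sum>i<h. x i) = \<Sum>?P - \<Sum>?Q" .
  moreover have "card ?P + card ?Q = h"
  proof -
    have "card ?P + card ?Q = card ?I + card ?J"
      using inj_P inj_Q by (simp add: card_image)
    also have "\<dots> = card {..<h}"
      by (subst IJ(1), rule card_Un_disjoint[symmetric]) auto
    finally show ?thesis by simp
  qed
  moreover have "?P \<inter> ?Q = {}"
  proof -
    have False if "i \<in> ?I" "j \<in> ?J" "x i = - x j" for i j
    proof -
      have "i = j"
        using eq[of i j] that by simp
      with that show False by simp
    qed
    then show ?thesis by blast
  qed
  moreover have "?Q \<subseteq> A"
    using x by fastforce
  ultimately show ?thesis
    unfolding restricted_signed_sumset_eq[OF assms(1)]
    by (intro CollectI exI[of _ ?P] exI[of _ ?Q]) auto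
qed

text \<open>
  Fixing the summands in \<open>D\<close>, all with sign \<open>+1\<close>, translates the smaller sumset into the larger one. This
  makes it possible to pass to convenient subsets.
\<close>

lemma card_restricted_signed_sumset_mono:
  assumes "finite A" "A' \<subseteq> A" "D \<subseteq> A" "A' \<inter> D = {}"
  shows "card (restricted_signed_sumset h A') \<le> card (restricted_signed_sumset (h + card D) A)"
proof -
  have fin: "finite A'" "finite D"
    using finite_subset[OF assms(2,1)] finite_subset[OF assms(3,1)] by auto
  have "(+) (\<Sum>D) ` restricted_signed_sumset h A' \<subseteq> restricted_signed_sumset (h + card D) A"
  proof
    fix y assume "y \<in> (+) (\<Sum>D) ` restricted_signed_sumset h A'"
    then obtain P Q where PQ: "P \<subseteq> A'" "Q \<subseteq> A'" "P \<inter> Q = {}" "card P + card Q = h"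
      and y: "y = \<Sum>D + (\<Sum>P - \<Sum>Q)"
      unfolding restricted_signed_sumset_eq[OF fin(1)] by blast
    have PD: "finite P" "P \<inter> D = {}"
      using PQ assms fin finite_subset by auto
    then have "y = \<Sum>(P \<union> D) - \<Sum>Q" "card (P \<union> D) + card Q = h + card D"
      using PQ fin by (simp_all add: y sum.union_disjoint card_Un_disjoint)
    moreover have "P \<union> D \<subseteq> A" "Q \<subseteq> A" "(P \<union> D) \<inter> Q = {}"
      using PQ assms by auto
    ultimately show "y \<in> restricted_signed_sumset (h + card D) A"
      unfolding restricted_signed_sumset_eq[OF assms(1)]
      by (intro CollectI exI[of _ "P \<union> D"] exI[of _ Q] conjI)
  qed
  then have "card ((+) (\<Sum>D) ` restricted_signed_sumset h A') \<le> card (restricted_signed_sumset (h + card D) A)"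
    by (intro card_mono finite_restricted_signed_sumset assms)
  then show ?thesis
    by (simp add: card_image)
qed

lemma inj_on_if_det_power_matrix_neq_0:
  fixes y :: "nat \<Rightarrow> 'a::field"
  assumes "det (mat h h (\<lambda>(i, j). y i ^ j)) \<noteq> 0"
  shows "inj_on y {..<h}"
proof (rule inj_onI)
  fix i j assume ij: "i \<in> {..<h}" "j \<in> {..<h}" "y i = y j"
  show "i = j"
  proof (rule ccontr)
    assume "i \<noteq> j"
    then have "det (mat h h (\<lambda>(i, j). y i ^ j)) = 0"
      using ij by (intro det_identical_rows[of _ h i j]) (auto intro!: eq_vecI)
    with assms show False by contradiction
  qed
qed

section \<open>The bound of Dias da Silva and Hamidoune\<close>

text \<open>
  Writing \<open>M \<le> h w\<close> as a sum of \<open>h\<close> numbers from \<open>{0..w}\<close> by filling up one summand after the other.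
\<close>

lemma sum_min_diff_mult: "(\<Sum>t<h. min w (M - t * w)) = min M (h * w)" for w M :: nat
proof (induction h)
  case (Suc h)
  then show ?case
    by (auto simp: min_def)
qed simp

lemma double_sum_lessThan: "2 * (\<Sum>i<h. i) = h * (h - 1)" for h :: nat
proof (induction h)
  case (Suc h)
  then show ?case
    by (cases h) (simp_all add: algebra_simps)
qed simp

text \<open>
  The degrees \<open>c i\<close> are strictly increasing numbers below \<open>card A\<close> that exceed \<open>0, \<dots>, h - 1\<close> by \<open>M\<close> in total.
  As \<open>card A \<le> p\<close>, they remain distinct in the field.
\<close>

lemma card_restricted_sumset_gt_if_fact_neq_0:
  fixes A :: "'a::field set"
  assumes A: "finite A" and h: "0 < h" "h \<le> card A" and M: "M \<le> h * (card A - h)"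
    and fact_M: "of_nat (fact M) \<noteq> (0::'a)" and fact_A: "of_nat (fact (card A - 1)) \<noteq> (0::'a)"
  shows "M < card (restricted_signed_sumset h A)"
proof -
  define w where "w = card A - h"
  \<comment> \<open>the largest degrees are raised by \<open>w\<close> first\<close>
  define c where "c i = i + min w (M - (h - Suc i) * w)" for i
  have c_less: "c i < card A" if "i < h" for i
    using that h by (auto simp: c_def w_def min_def)
  have "strict_mono_on {..<h} c"
  proof (rule strict_mono_onI)
    fix i j assume "i \<in> {..<h}" "j \<in> {..<h}" "i < j"
    then have "(h - Suc j) * w \<le> (h - Suc i) * w"
      by (intro mult_le_mono1 diff_le_mono2) simp
    then have "M - (h - Suc i) * w \<le> M - (h - Suc j) * w"
      by (rule diff_le_mono2)
    with \<open>i < j\<close> show "c i < c j"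
      unfolding c_def by (intro add_less_le_mono min.mono) auto
  qed
  then have inj_c: "inj_on c {..<h}"
    by (rule strict_mono_on_imp_inj_on)
  have "(\<Sum>i<h. c i) = (\<Sum>i<h. i) + (\<Sum>i<h. min w (M - (h - Suc i) * w))"
    by (simp add: c_def sum.distrib)
  also have "(\<Sum>i<h. min w (M - (h - Suc i) * w)) = (\<Sum>i<h. min w (M - i * w))"
    by (rule sum.nat_diff_reindex)
  also have "\<dots> = M"
    using M by (simp add: sum_min_diff_mult w_def)
  finally have sum_c: "M + (\<Sum>j<h. j) = (\<Sum>i<h. c i)"
    by simp
  show ?thesis
  proof (rule card_gt_if_nonsingular_sums_of_subset_in[OF _ A c_less sum_c fact_M])
    show "finite (restricted_signed_sumset h A)"
      using A by (rule finite_restricted_signed_sumset)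
    show "det (mat h h (\<lambda>(i, j). inv_fact_diff (c i) j :: 'a)) \<noteq> 0"
    proof (rule det_inv_fact_diff_neq_0)
      fix j assume "j < h"
      show "of_nat (fact (c j)) \<noteq> (0::'a)"
        by (rule fact_neq_0_mono[OF fact_A]) (use c_less[OF \<open>j < h\<close>] in simp)
    next
      fix v :: "nat \<Rightarrow> 'a" and i
      assume roots: "\<And>j. j < h \<Longrightarrow>
          poly (\<Sum>i<h. smult (v i) (falling_factorial_poly i)) (of_nat (c j)) = 0"
        and "i < h"
      show "v i = 0"
      proof (rule falling_factorial_coeffs_eq_0_if_roots[OF roots fact_A _ inj_c \<open>i < h\<close>])
        show "c j \<le> card A - 1" if "j < h" for j
          using c_less[OF that] by simp
      qed
    qed
    show "(\<Sum>i<h. x i) \<in> restricted_signed_sumset h A"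
      if "\<And>i. i < h \<Longrightarrow> x i \<in> A" and "det (mat h h (\<lambda>(i, j). x i ^ j)) \<noteq> 0" for x
      by (rule sum_in_restricted_signed_sumset[OF A that(1) inj_on_if_det_power_matrix_neq_0[OF that(2)]])
  qed
qed

text \<open>
  If \<open>card A > p\<close>, the previous lemma is applied to a subset of exactly \<open>p\<close> elements, with at most \<open>p - 1\<close>
  summands, while the other summands are fixed outside that subset. This is enough since only
  \<open>M \<le> p - 1\<close> is needed.
\<close>

theorem card_restricted_signed_sumset_gt:
  fixes A :: "'a::field set"
  assumes A: "finite A" and h: "0 < h" "h \<le> card A" and M: "M \<le> h * (card A - h)"
    and fact_M: "of_nat (fact M) \<noteq> (0::'a)"
  shows "M < card (restricted_signed_sumset h A)"
proof (cases "of_nat (fact (card A - 1)) = (0::'a)")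
  case False
  with assms show ?thesis
    by (rule card_restricted_sumset_gt_if_fact_neq_0)
next
  case True
  \<comment> \<open>the characteristic, as the least number whose factorial vanishes\<close>
  define p where "p = (LEAST n. of_nat (fact n) = (0::'a))"
  have fact_p: "of_nat (fact p) = (0::'a)"
    unfolding p_def using True by (rule LeastI)
  have fact_less_p: "of_nat (fact n) \<noteq> (0::'a)" if "n < p" for n
    using not_less_Least[of n "\<lambda>n. of_nat (fact n) = (0::'a)"] that by (simp add: p_def)
  have "p \<le> card A - 1"
    unfolding p_def using True by (rule Least_le)
  have "M < p"
  proof (rule ccontr)
    assume "\<not> M < p"
    then have "p \<le> M" by simp
    from fact_neq_0_mono[OF fact_M this] fact_p show False
      by contradiction
  qed
  have "2 \<le> p"
  proof (rule ccontr)
    assume "\<not> 2 \<le> p"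
    then have "p = 0 \<or> p = 1"
      by auto
    with fact_p show False by auto
  qed
  show ?thesis
  proof (cases "M = 0")
    case True
    then show ?thesis
      using card_restricted_signed_sumset_gt_0[OF A h(2)] by simp
  next
    case False
    with M have "h < card A"
      by (cases "h = card A") (use h in auto)
    \<comment> \<open>with \<open>1 \<le> h' \<le> p - 1\<close> one has \<open>h' (p - h') \<ge> p - 1\<close>\<close>
    define h' where "h' = min h (p - 1)"
    have h': "0 < h'" "h' \<le> h" "h' \<le> p - 1"
      using h \<open>2 \<le> p\<close> by (auto simp: h'_def)
    have "p \<le> card A"
      using \<open>p \<le> card A - 1\<close> by simp
    from obtain_subset_with_card_n[OF this] obtain A' where A': "A' \<subseteq> A" "card A' = p"
      by blast
    have "finite A'"
      using A'(1) A by (rule finite_subset)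
    have "card (A - A') = card A - p"
      using A' \<open>finite A'\<close> by (simp add: card_Diff_subset)
    then have "h - h' \<le> card (A - A')"
      using \<open>p \<le> card A - 1\<close> \<open>h < card A\<close> \<open>2 \<le> p\<close> by (auto simp: h'_def)
    from obtain_subset_with_card_n[OF this] obtain D where D: "D \<subseteq> A - A'" "card D = h - h'"
      by blast
    have "M < card (restricted_signed_sumset h' A')"
    proof (rule card_restricted_sumset_gt_if_fact_neq_0)
      obtain a where a: "h' = Suc a"
        using h'(1) by (cases h') auto
      moreover obtain b where b: "p - h' = Suc b"
        using h' \<open>2 \<le> p\<close> by (cases "p - h'") auto
      ultimately have "p = Suc a + Suc b"
        by simp
      then have "p - 1 \<le> h' * (p - h')"
        unfolding a b by simp
      then show "M \<le> h' * (card A' - h')"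
        using A'(2) \<open>M < p\<close> by simp
      show "of_nat (fact (card A' - 1)) \<noteq> (0::'a)"
        unfolding A'(2) by (rule fact_less_p) (use \<open>2 \<le> p\<close> in simp)
      show "h' \<le> card A'"
        using A'(2) h' by simp
    qed (rule \<open>finite A'\<close> h'(1) fact_M)+
    also have "\<dots> \<le> card (restricted_signed_sumset (h' + card D) A)"
      using A A' D by (intro card_restricted_signed_sumset_mono) auto
    also have "h' + card D = h"
      using D h' by simp
    finally show ?thesis .
  qed
qed

section \<open>Sums of signed elements with distinct squares\<close>

lemma inv_fact_diff_commute:
  "a \<le> m \<Longrightarrow> b \<le> m \<Longrightarrow> inv_fact_diff (m - a) b = inv_fact_diff (m - b) a"
  by (auto simp: inv_fact_diff_def add.commute)

text \<open>
  The degrees are \<open>c\<^sub>i = n - 1 - s\<^sub>i\<close> and the exponents \<open>e\<^sub>j = 2 j\<close>. Then \<open>c\<^sub>i - e\<^sub>j = (n - 1 - 2 j) - s\<^sub>i\<close>, so that, after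
  transposition, the determinant is of the kind treated above with the points \<open>n - 1 - 2 j\<close> and the
  falling factorials of index \<open>s\<^sub>i\<close>.
\<close>

lemma card_restricted_signed_sumset_gt_if_independent:
  fixes A :: "'a::field set"
  assumes A: "finite A" "n \<le> card (A \<union> uminus ` A)" and n: "2 * h \<le> Suc n"
    and s: "\<And>i. i < h \<Longrightarrow> s i < n"
    and fact_n: "of_nat (fact (n - 1)) \<noteq> (0::'a)"
    and N: "N + h * (h - 1) = (\<Sum>i<h. n - 1 - s i)" and fact_N: "of_nat (fact N) \<noteq> (0::'a)"
    and indep: "\<And>v i. (\<And>j. j < h \<Longrightarrow>
        poly (\<Sum>i<h. smult (v i) (falling_factorial_poly (s i))) (of_nat (n - 1 - 2 * j)) = (0::'a)) \<Longrightarrow>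
        i < h \<Longrightarrow> v i = 0"
  shows "N < card (restricted_signed_sumset h A)"
proof (rule card_gt_if_nonsingular_sums_of_subset_in[where c = "\<lambda>i. n - 1 - s i" and e = "\<lambda>j. 2 * j"])
  let ?H = "mat h h (\<lambda>(j, i). inv_fact_diff (n - 1 - 2 * j) (s i) :: 'a)"
  have "mat h h (\<lambda>(i, j). inv_fact_diff (n - 1 - s i) (2 * j) :: 'a) = transpose_mat ?H"
  proof (rule eq_matI)
    fix i j assume "i < dim_row (transpose_mat ?H)" "j < dim_col (transpose_mat ?H)"
    then have ij: "i < h" "j < h"
      by simp_all
    have "inv_fact_diff (n - 1 - s i) (2 * j) = (inv_fact_diff (n - 1 - 2 * j) (s i) :: 'a)"
      by (rule inv_fact_diff_commute) (use s[OF ij(1)] ij n in auto)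
    with ij show "mat h h (\<lambda>(i, j). inv_fact_diff (n - 1 - s i) (2 * j)) $$ (i, j) = transpose_mat ?H $$ (i, j)"
      by simp
  qed auto
  moreover have "det ?H \<noteq> 0"
  proof (rule det_inv_fact_diff_neq_0)
    show "of_nat (fact (n - 1 - 2 * j)) \<noteq> (0::'a)" for j
      by (rule fact_neq_0_mono[OF fact_n]) simp
  qed (fact indep)
  ultimately show "det (mat h h (\<lambda>(i, j). inv_fact_diff (n - 1 - s i) (2 * j) :: 'a)) \<noteq> 0"
    by (simp add: det_transpose[of _ h])
  show "N + (\<Sum>j<h. 2 * j) = (\<Sum>i<h. n - 1 - s i)"
    using N by (simp add: sum_distrib_left[symmetric] double_sum_lessThan)
  show "n - 1 - s i < card (A \<union> uminus ` A)" if "i < h" for i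
    using s[OF that] A(2) by simp
  show "(\<Sum>i<h. x i) \<in> restricted_signed_sumset h A"
    if "\<And>i. i < h \<Longrightarrow> x i \<in> A \<union> uminus ` A"
      and det: "det (mat h h (\<lambda>(i, j). x i ^ (2 * j))) \<noteq> 0" for x
  proof (rule sum_signed_in_restricted_signed_sumset[OF A(1) that(1)])
    show "inj_on (\<lambda>i. (x i)\<^sup>2) {..<h}"
      using det by (intro inj_on_if_det_power_matrix_neq_0) (simp add: power_mult)
  qed
qed (use A(1) fact_N finite_restricted_signed_sumset in auto)

text \<open>
  The case of consecutive degrees, \<open>s\<^sub>i = i\<close>. The condition \<open>n \<ge> 2 h - 1\<close> says that none of the points
  \<open>n - 1 - 2 j\<close> is negative.
\<close>

lemma card_restricted_signed_sumset_gt_if_wide: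
  fixes A :: "'a::field set"
  assumes "finite A" "n \<le> card (A \<union> uminus ` A)" "0 < h" and n: "2 * h \<le> Suc n"
    and fact_n: "of_nat (fact (n - 1)) \<noteq> (0::'a)"
    and N: "2 * N + h * (3 * h - 1) = 2 * h * n" and "of_nat (fact N) \<noteq> (0::'a)"
  shows "N < card (restricted_signed_sumset h A)"
proof (rule card_restricted_signed_sumset_gt_if_independent[where s = "\<lambda>i. i", OF assms(1,2) n])
  have "(\<Sum>i<h. n - 1 - i) + (\<Sum>i<h. i) = (\<Sum>i<h. n - 1)"
    unfolding sum.distrib[symmetric] using n by (intro sum.cong refl) auto
  then have "2 * (\<Sum>i<h. n - 1 - i) + h * (h - 1) = 2 * (h * (n - 1))"
    unfolding double_sum_lessThan[symmetric] by simp
  moreover obtain h' n' where "h = Suc h'" "n = Suc n'"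
    using \<open>0 < h\<close> n by (cases h; cases n) auto
  ultimately show "N + h * (h - 1) = (\<Sum>i<h. n - 1 - i)"
    using N by (simp add: algebra_simps)
  fix v :: "nat \<Rightarrow> 'a" and i
  assume roots: "\<And>j. j < h \<Longrightarrow>
      poly (\<Sum>i<h. smult (v i) (falling_factorial_poly i)) (of_nat (n - 1 - 2 * j)) = 0"
    and "i < h"
  show "v i = 0"
    by (rule falling_factorial_coeffs_eq_0_if_roots[OF roots fact_n _ _ \<open>i < h\<close>])
      (use n in \<open>auto simp: inj_on_def\<close>)
qed (use assms in auto)

section \<open>Sums of all elements with arbitrary signs\<close>

lemma card_Un_uminus_image:
  fixes A :: "'a::field set"
  assumes "finite A" "inj_on (\<lambda>a. a\<^sup>2) A" "0 \<notin> A" "(2::'a) \<noteq> 0"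
  shows "card (A \<union> uminus ` A) = 2 * card A"
proof -
  have False if "a \<in> A" "b \<in> A" "a = - b" for a b
  proof -
    have "a = b"
      using that inj_onD[OF assms(2), of a b] by simp
    have "b = - b"
      using that(3) unfolding \<open>a = b\<close> .
    then have "2 * b = 0"
      unfolding mult_2 by (rule iffD1[OF eq_neg_iff_add_eq_0])
    with assms(3,4) that(2) show False
      by auto
  qed
  then have "A \<inter> uminus ` A = {}"
    by blast
  moreover have "card (uminus ` A) = card A"
    by (intro card_image) simp
  ultimately show ?thesis
    using assms(1) by (simp add: card_Un_disjoint)
qed

text \<open>
  Here \<open>n = 2 e\<close>, and the degrees run through \<open>2 e - 1, \<dots>, e - 1\<close> with the exception of \<open>2 e - 1 - r\<close>. Omitting that
  value lowers \<open>N\<close> by \<open>e - r\<close> from the triangular number that belongs to \<open>r = e\<close>.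
\<close>

lemma card_sign_sums_gt_if_gap:
  fixes A :: "'a::field set"
  assumes A: "finite A" "inj_on (\<lambda>a. a\<^sup>2) A" "0 \<notin> A" "(2::'a) \<noteq> 0" and card_A: "card A = e"
    and r: "0 < r" "r \<le> e" and N: "2 * (N + (e - r)) = e * (e + 1)" and N_ge: "2 * e - 1 \<le> N"
    and fact_N: "of_nat (fact N) \<noteq> (0::'a)"
  shows "N < card (restricted_signed_sumset e A)"
proof (rule card_restricted_signed_sumset_gt_if_independent
    [where n = "2 * e" and s = "\<lambda>i. if i < r then i else Suc i"])
  let ?s = "\<lambda>i. if i < r then i else Suc i"
  show fact_e: "of_nat (fact (2 * e - 1)) \<noteq> (0::'a)"
    using fact_N N_ge by (rule fact_neq_0_mono)
  have "(\<Sum>i<e. 2 * e - 1 - ?s i) + (\<Sum>i<e. ?s i) = (\<Sum>i<e. 2 * e - 1)"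
    unfolding sum.distrib[symmetric] by (intro sum.cong refl) auto
  moreover have "(\<Sum>i<e. if i < r then 0 else 1) = e - r"
    by (induction e) auto
  moreover have "(\<Sum>i<e. ?s i) = (\<Sum>i<e. i) + (\<Sum>i<e. if i < r then 0 else 1)"
    unfolding sum.distrib[symmetric] by (intro sum.cong refl) auto
  ultimately have "2 * (\<Sum>i<e. 2 * e - 1 - ?s i) + e * (e - 1) + 2 * (e - r) = 2 * (e * (2 * e - 1))"
    unfolding double_sum_lessThan[symmetric] by simp
  moreover obtain e' where "e = Suc e'"
    using r by (cases e) auto
  ultimately show "N + e * (e - 1) = (\<Sum>i<e. 2 * e - 1 - ?s i)"
    using N by (simp add: algebra_simps)
  show "?s i < 2 * e" if "i < e" for i
    using that by auto
  show "2 * e \<le> card (A \<union> uminus ` A)"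
    using card_Un_uminus_image[OF A] card_A by simp
  fix v :: "nat \<Rightarrow> 'a" and i
  assume roots: "\<And>j. j < e \<Longrightarrow>
      poly (\<Sum>i<e. smult (v i) (falling_factorial_poly (?s i))) (of_nat (2 * e - 1 - 2 * j)) = 0"
    and "i < e"
  show "v i = 0"
  proof (rule falling_factorial_coeffs_with_gap_eq_0_if_odd_roots[OF _ r fact_e \<open>i < e\<close>])
    fix j assume "j < e"
    then have "2 * e - 1 - 2 * (e - 1 - j) = 2 * j + 1" "e - 1 - j < e"
      by auto
    with roots[of "e - 1 - j"]
    show "poly (\<Sum>i<e. smult (v i) (falling_factorial_poly (?s i))) (of_nat (2 * j + 1)) = 0"
      by (simp only:)
  qed
qed (use A(1) fact_N in auto)

text \<open>
  If \<open>S\<close> were closed under adding \<open>t\<close>, it would contain a progression of \<open>card S + 1\<close> distinct elements.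
\<close>

lemma card_less_card_Un_translate:
  fixes S :: "'a::field set"
  assumes "finite S" "S \<noteq> {}" "t \<noteq> 0" and fact_S: "of_nat (fact (card S)) \<noteq> (0::'a)"
  shows "card S < card (S \<union> (+) t ` S)"
proof (rule ccontr)
  assume "\<not> card S < card (S \<union> (+) t ` S)"
  then have "S \<union> (+) t ` S = S"
    using assms(1) by (intro card_seteq[symmetric]) auto
  then have closed: "t + y \<in> S" if "y \<in> S" for y
    using that by blast
  obtain x where "x \<in> S"
    using assms(2) by blast
  have "x + of_nat i * t \<in> S" for i
  proof (induction i)
    case (Suc i)
    then show ?case
      using closed[of "x + of_nat i * t"] by (simp add: algebra_simps)
  qed (use \<open>x \<in> S\<close> in simp)
  moreover have "inj_on (\<lambda>i. x + of_nat i * t) {..card S}"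
  proof (rule inj_onI)
    fix i j assume "i \<in> {..card S}" "j \<in> {..card S}" "x + of_nat i * t = x + of_nat j * t"
    then show "i = j"
      using \<open>t \<noteq> 0\<close> by (intro inj_onD[OF inj_on_of_nat_if_fact[OF fact_S]]) auto
  qed
  ultimately have "card {..card S} \<le> card S"
    using assms(1) by (intro card_inj_on_le) auto
  then show False by simp
qed

lemma restricted_signed_sumset_insert:
  assumes "finite A" "a \<notin> A" "y \<in> restricted_signed_sumset h A"
  shows "y + a \<in> restricted_signed_sumset (Suc h) (insert a A)"
    and "y - a \<in> restricted_signed_sumset (Suc h) (insert a A)"
proof -
  obtain P Q where PQ: "P \<subseteq> A" "Q \<subseteq> A" "P \<inter> Q = {}" "card P + card Q = h"
    and y: "y = \<Sum>P - \<Sum>Q"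
    using assms(3) unfolding restricted_signed_sumset_eq[OF assms(1)] by blast
  have fin: "finite P" "finite Q" "a \<notin> P" "a \<notin> Q"
    using PQ assms(1,2) finite_subset by auto
  have eq: "restricted_signed_sumset (Suc h) (insert a A) = {\<Sum>P - \<Sum>Q | P Q.
      P \<subseteq> insert a A \<and> Q \<subseteq> insert a A \<and> P \<inter> Q = {} \<and> card P + card Q = Suc h}"
    using assms(1) by (intro restricted_signed_sumset_eq) simp
  show "y + a \<in> restricted_signed_sumset (Suc h) (insert a A)"
    unfolding eq using PQ fin
    by (intro CollectI exI[of _ "insert a P"] exI[of _ Q]) (auto simp: y)
  show "y - a \<in> restricted_signed_sumset (Suc h) (insert a A)"
    unfolding eq using PQ fin
    by (intro CollectI exI[of _ P] exI[of _ "insert a Q"]) (auto simp: y)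
qed

text \<open>
  Only \<open>e\<close> of the signs are varied, where \<open>e\<close> is minimal with \<open>M \<le> e (e + 1) / 2\<close>, and \<open>r\<close> is chosen so that the
  previous construction yields exactly \<open>M\<close>. That construction needs \<open>2 e - 1 \<le> M\<close>, which may fail
  only if \<open>M\<close> exceeds the preceding triangular number by \<open>1\<close>. In that case it is applied to \<open>e - 1\<close> signs,
  and the one missing sum is gained from the last sign, which adds a translate of the sumset.
\<close>

theorem card_sign_sums_gt:
  fixes A :: "'a::field set"
  assumes A: "finite A" "inj_on (\<lambda>a. a\<^sup>2) A" "0 \<notin> A" "(2::'a) \<noteq> 0"
    and M: "2 * M \<le> card A * (card A + 1)" and fact_M: "of_nat (fact M) \<noteq> (0::'a)"
  shows "M < card (restricted_signed_sumset (card A) A)"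
proof (cases "M = 0")
  case True
  then show ?thesis
    using card_restricted_signed_sumset_gt_0[OF A(1) order.refl] by simp
next
  case False
  define e where "e = (LEAST e. 2 * M \<le> e * (e + 1))"
  have M_le: "2 * M \<le> e * (e + 1)"
    unfolding e_def using M by (rule LeastI)
  have "e \<le> card A"
    unfolding e_def using M by (rule Least_le)
  obtain e' where e: "e = Suc e'"
    using M_le False by (cases e) auto
  have M_gt: "e' * (e' + 1) < 2 * M"
  proof -
    have "e' < e"
      by (simp add: e)
    then show ?thesis
      unfolding e_def by (metis (no_types, lifting) not_less not_less_Least)
  qed
  have "even (e * (e + 1))"
    by simp
  then obtain T where T: "e * (e + 1) = 2 * T"
    by (rule evenE)
  define r where "r = e - (T - M)"
  have T_e: "2 * T = e' * (e' + 1) + 2 * e"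
    using T by (simp add: e algebra_simps)
  have r: "0 < r" "r \<le> e" and N: "2 * (M + (e - r)) = e * (e + 1)"
    using M_le M_gt T T_e by (auto simp: r_def)
  have M_r: "M + (e - r) = T"
    using N T by simp
  have sq: "3 * e' \<le> e' * e' + 2"
  proof (cases "3 \<le> e'")
    case True
    then have "3 * e' \<le> e' * e'"
      by (rule mult_le_mono1)
    then show ?thesis
      by linarith
  next
    case False
    then have "e' = 0 \<or> e' = 1 \<or> e' = 2"
      by auto
    then show ?thesis
      by auto
  qed
  from obtain_subset_with_card_n[OF \<open>e \<le> card A\<close>]
  obtain A' where A': "A' \<subseteq> A" "card A' = e" "finite A'"
    by blast
  have A'_props: "inj_on (\<lambda>a. a\<^sup>2) B" "0 \<notin> B" if "B \<subseteq> A'" for B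
    using that A A'(1) by (auto intro: inj_on_subset)
  have "M < card (restricted_signed_sumset e A')"
  proof (cases "r = 1 \<and> 2 \<le> e")
    case False
    have "2 * e - 1 \<le> M"
    proof (cases "r = e")
      case True
      then have "2 * M = e' * e' + 3 * e' + 2"
        using N by (simp add: e)
      moreover have "e' \<le> e' * e'" "2 * e - 1 = 2 * e' + 1"
        by (simp_all add: e)
      ultimately show ?thesis
        by linarith
    next
      case False
      with \<open>\<not> (r = 1 \<and> 2 \<le> e)\<close> r have "2 \<le> r" by simp
      with M_r r(2) T_e have "e' * e' + e' + 4 \<le> 2 * M"
        unfolding e by simp
      then show ?thesis
        unfolding e using sq by simp
    qed
    then show ?thesis
      using card_sign_sums_gt_if_gap[OF A'(3) A'_props[OF order.refl] A(4) A'(2) r N _ fact_M] by simp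
  next
    case True
    have M_e: "2 * (M - 1) = e' * (e' + 1)"
      using M_r T_e True by (simp add: e)
    obtain a where "a \<in> A'"
      using A'(2) e by (metis card.empty ex_in_conv nat.distinct(1))
    let ?A = "A' - {a}"
    let ?S = "restricted_signed_sumset e' ?A"
    have card: "card ?A = e'" and fin: "finite ?A"
      using A' \<open>a \<in> A'\<close> e by simp_all
    have insert: "insert a ?A = A'"
      using \<open>a \<in> A'\<close> by blast
    have "M - 1 < card ?S"
    proof (rule card_sign_sums_gt_if_gap[where r = e', OF fin A'_props A(4) card])
      show "2 * e' - 1 \<le> M - 1"
        using M_e sq by simp
      show "of_nat (fact (M - 1)) \<noteq> (0::'a)"
        by (rule fact_neq_0_mono[OF fact_M]) simp
    qed (use M_e True e in auto)
    then have "M \<le> card ?S"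
      by simp
    \<comment> \<open>one sum short: the two signs of \<open>a\<close> give \<open>?S - a\<close> and its translate by \<open>2 a\<close>\<close>
    then consider "M < card ?S" | "M = card ?S"
      by linarith
    then show ?thesis
    proof cases
      case 1
      also have "card ?S \<le> card (restricted_signed_sumset (e' + card {a}) A')"
        using A' \<open>a \<in> A'\<close> by (intro card_restricted_signed_sumset_mono) auto
      finally show ?thesis
        by (simp add: e)
    next
      case 2
      have "a + a \<noteq> 0"
        using A(3,4) A' \<open>a \<in> A'\<close> by (auto simp: mult_2[symmetric])
      moreover have "?S \<noteq> {}"
        using fin card by (intro restricted_signed_sumset_neq_empty) simp_all
      ultimately have "M < card (?S \<union> (+) (a + a) ` ?S)"
        using card_less_card_Un_translate[of ?S "a + a"] 2 fact_M fin
        by (simp add: finite_restricted_signed_sumset)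
      also have "\<dots> = card ((\<lambda>y. y - a) ` (?S \<union> (+) (a + a) ` ?S))"
        by (intro card_image[symmetric]) (auto simp: inj_on_def)
      also have "\<dots> \<le> card (restricted_signed_sumset e A')"
      proof (rule card_mono)
        show "finite (restricted_signed_sumset e A')"
          using A'(3) by (rule finite_restricted_signed_sumset)
        have "y - a \<in> restricted_signed_sumset e A'" "a + a + y - a \<in> restricted_signed_sumset e A'"
          if "y \<in> ?S" for y
        proof -
          have "a + a + y - a = y + a"
            by simp
          then show "y - a \<in> restricted_signed_sumset e A'" "a + a + y - a \<in> restricted_signed_sumset e A'"
            using restricted_signed_sumset_insert[OF fin _ that, of a] unfolding insert e by (simp_all add: add.commute)
        qed
        then show "(\<lambda>y. y - a) ` (?S \<union> (+) (a + a) ` ?S) \<subseteq> restricted_signed_sumset e A'"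
          by blast
      qed
      finally show ?thesis .
    qed
  qed
  also have "\<dots> \<le> card (restricted_signed_sumset (e + card (A - A')) A)"
    using A(1) A' by (intro card_restricted_signed_sumset_mono) auto
  also have "e + card (A - A') = card A"
    using A' \<open>e \<le> card A\<close> by (simp add: card_Diff_subset)
  finally show ?thesis .
qed

section \<open>Comparison with the bound of the theorem\<close>

lemma ex_square_representatives:
  fixes A :: "'a::field set"
  assumes "finite A"
  obtains T where "T \<subseteq> A" "inj_on (\<lambda>a. a\<^sup>2) T" "0 \<notin> T" "card (A \<union> uminus ` A) \<le> 2 * card T + 1"
proof -
  obtain T where T: "T \<subseteq> A - {0}" "inj_on (\<lambda>a. a\<^sup>2) T" "(\<lambda>a. a\<^sup>2) ` (A - {0}) = (\<lambda>a. a\<^sup>2) ` T"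
    using subset_image_inj[of "(\<lambda>a. a\<^sup>2) ` (A - {0})" "\<lambda>a. a\<^sup>2" "A - {0}"] by auto
  have fin: "finite T"
    using T(1) assms by (meson finite_Diff finite_subset)
  have "A \<union> uminus ` A \<subseteq> insert 0 (T \<union> uminus ` T)"
  proof
    fix x assume "x \<in> A \<union> uminus ` A"
    then obtain a where a: "a \<in> A" "x = a \<or> x = - a"
      by auto
    show "x \<in> insert 0 (T \<union> uminus ` T)"
    proof (cases "a = 0")
      case False
      with a T(3) have "a\<^sup>2 \<in> (\<lambda>a. a\<^sup>2) ` T"
        by (metis DiffI imageI singletonD)
      then obtain t where "t \<in> T" "a\<^sup>2 = t\<^sup>2"
        by blast
      then show ?thesis
        using a(2) by (auto simp: power2_eq_iff)
    qed (use a in auto)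
  qed
  then have "card (A \<union> uminus ` A) \<le> card (insert 0 (T \<union> uminus ` T))"
    using fin by (intro card_mono) auto
  also have "\<dots> \<le> Suc (card (T \<union> uminus ` T))"
    by (rule card_insert_le_m1) auto
  also have "card (T \<union> uminus ` T) \<le> card T + card T"
    by (rule order.trans[OF card_Un_le add_left_mono[OF card_image_le[OF fin]]])
  finally have "card (A \<union> uminus ` A) \<le> 2 * card T + 1"
    by simp
  with T(1,2) show thesis
    by (intro that[of T]) auto
qed

text \<open>
  Here \<open>t\<close> stands for the number of nonzero classes of \<open>A\<close> modulo sign. If \<open>t \<ge> h - 1\<close>, the condition
  \<open>n \<le> 2 h - 2\<close> gives \<open>2 N \<le> (h - 1) h\<close>. Otherwise \<open>n \<le> 2 t + 1\<close> gives
  \<open>2 N \<le> t (t + 1) - (h - t - 1) (3 h - t)\<close>.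
\<close>

lemma narrow_bound_le_triangular:
  fixes N h n t :: nat
  assumes N: "2 * N + h * (3 * h - 1) = 2 * h * n" and n: "n + 2 \<le> 2 * h" "n \<le> 2 * t + 1"
  shows "2 * N \<le> min h t * (min h t + 1)"
proof -
  have "0 < h"
    using n by simp
  have N': "2 * int N = 2 * int h * int n - int h * (3 * int h - 1)"
    using arg_cong[OF N, of int] \<open>0 < h\<close> by (simp add: of_nat_diff)
  have "2 * int N \<le> int (min h t) * (int (min h t) + 1)"
  proof (cases "h \<le> t + 1")
    case True
    have "2 * int N \<le> 2 * int h * (2 * int h - 2) - int h * (3 * int h - 1)"
      unfolding N' using n(1) by (intro diff_right_mono mult_left_mono) auto
    also have "\<dots> \<le> (int h - 1) * int h"
      by (simp add: algebra_simps)
    also have "\<dots> \<le> int (min h t) * (int (min h t) + 1)"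
      using True \<open>0 < h\<close> by (intro mult_mono) auto
    finally show ?thesis .
  next
    case False
    have "2 * int N \<le> 2 * int h * (2 * int t + 1) - int h * (3 * int h - 1)"
      unfolding N' using n(2) by (intro diff_right_mono mult_left_mono) auto
    also have "\<dots> = int t * (int t + 1) - (int h - int t - 1) * (3 * int h - int t)"
      by (simp add: algebra_simps)
    also have "\<dots> \<le> int t * (int t + 1)"
    proof -
      have "0 \<le> (int h - int t - 1) * (3 * int h - int t)"
        using False by (intro mult_nonneg_nonneg) auto
      then show ?thesis by linarith
    qed
    finally show ?thesis
      using False by (simp add: min_def)
  qed
  then show ?thesis
    by (metis (mono_tags, lifting) of_nat_1 of_nat_add of_nat_le_iff of_nat_mult of_nat_numeral)
qed

text \<open>
  Usually \<open>n - 1 \<le> N\<close>. The exceptions are \<open>h = 2, n = 3\<close> and \<open>h = 3, n = 5\<close>, where the factorial in question has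
  no prime factors besides \<open>2\<close> and those of \<open>N!\<close>.
\<close>

lemma fact_pred_neq_0_if_wide:
  fixes N h n :: nat
  assumes "2 \<le> h" "2 * h \<le> Suc n" and N: "2 * N + h * (3 * h - 1) = 2 * h * n"
    and two: "(2::'a::field) \<noteq> 0" and fact_N: "of_nat (fact N) \<noteq> (0::'a)"
  shows "of_nat (fact (n - 1)) \<noteq> (0::'a)"
proof (cases "n - 1 \<le> N")
  case True
  with fact_N show ?thesis
    by (rule fact_neq_0_mono)
next
  case False
  then have "int N + 1 < int n"
    by simp
  have N': "2 * int N = 2 * int h * int n - int h * (3 * int h - 1)"
    using arg_cong[OF N, of int] \<open>2 \<le> h\<close> by (simp add: of_nat_diff)
  have "(int h - 1) * (2 * int n - 3 * int h - 2) = 2 * int N - 2 * (int n - 1)"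
    unfolding N' by (simp add: algebra_simps)
  also have "\<dots> < 0"
    using \<open>int N + 1 < int n\<close> by (simp only: right_diff_distrib)
  finally have "2 * int n - 3 * int h - 2 < 0"
    using \<open>2 \<le> h\<close> by (simp add: mult_less_0_iff)
  then have "(h = 2 \<and> n = 3) \<or> (h = 3 \<and> n = 5)"
    using assms(1,2) by presburger
  then show ?thesis
  proof (elim disjE conjE)
    assume "n = 3"
    with two show ?thesis by (simp add: fact_numeral)
  next
    assume n: "h = 3" "n = 5"
    with N have "N = 3" by simp
    have "of_nat (fact (n - 1)) = 2 * 2 * (of_nat (fact N) :: 'a)"
      unfolding n \<open>N = 3\<close> by (simp add: fact_numeral)
    also have "\<dots> \<noteq> 0"
      by (intro no_zero_divisors two fact_N)
    finally show ?thesis .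
  qed
qed

text \<open>
  The common form of the bounds \<open>\<theta> + 1\<close> (for \<open>n = card (A \<union> - A)\<close>) and \<open>\<theta> - \<ell> h + 1\<close> (for \<open>n\<close> smaller by \<open>\<ell>\<close>).
\<close>

theorem card_restricted_signed_sumset_gt_if_sized:
  fixes A :: "'a::field set"
  assumes A: "finite A" and h: "2 \<le> h" "h \<le> card A" and n: "n \<le> card (A \<union> uminus ` A)"
    and two: "(2::'a) \<noteq> 0"
    and N: "2 * N + h * (3 * h - 1) = 2 * h * n" and fact_N: "of_nat (fact N) \<noteq> (0::'a)"
  shows "N < card (restricted_signed_sumset h A)"
proof (cases "2 * h \<le> Suc n")
  case True
  show ?thesis
    by (rule card_restricted_signed_sumset_gt_if_wide[OF A n _ True
          fact_pred_neq_0_if_wide[OF h(1) True N two fact_N] N fact_N]) (use h in simp)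
next
  case False
  obtain T where T: "T \<subseteq> A" "inj_on (\<lambda>a. a\<^sup>2) T" "0 \<notin> T" "card (A \<union> uminus ` A) \<le> 2 * card T + 1"
    using ex_square_representatives[OF A] .
  define d where "d = min h (card T)"
  have "d \<le> card T"
    by (simp add: d_def)
  from obtain_subset_with_card_n[OF this] obtain T' where T': "T' \<subseteq> T" "card T' = d" "finite T'"
    by blast
  have "T' \<subseteq> A"
    using T' T by blast
  then have "card (A - T') = card A - d"
    using T' by (simp add: card_Diff_subset)
  then have "h - d \<le> card (A - T')"
    using h by (simp add: diff_le_mono)
  from obtain_subset_with_card_n[OF this] obtain D where D: "D \<subseteq> A - T'" "card D = h - d"
    by blast
  have "N < card (restricted_signed_sumset (card T') T')"
  proof (rule card_sign_sums_gt)
    show "2 * N \<le> card T' * (card T' + 1)"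
      unfolding T'(2) d_def using False n T(4) by (intro narrow_bound_le_triangular[OF N]) simp_all
    show "inj_on (\<lambda>a. a\<^sup>2) T'"
      using T(2) T'(1) by (rule inj_on_subset)
    show "0 \<notin> T'"
      using T T' by blast
  qed (rule T'(3) two fact_N)+
  also have "\<dots> \<le> card (restricted_signed_sumset (card T' + card D) A)"
    using A \<open>T' \<subseteq> A\<close> D by (intro card_restricted_signed_sumset_mono) auto
  also have "card T' + card D = h"
    using T' D by (simp add: d_def)
  finally show ?thesis .
qed

text \<open>
  If \<open>i\<close> vanishes in the field for some \<open>0 < i \<le> M\<close>, then \<open>0, 1, \<dots>, i - 1\<close> already form a subgroup.
\<close>

lemma fact_neq_0_if_less_min_subgroup_order:
  assumes "enat M < min_subgroup_order TYPE('a::field)"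
  shows "of_nat (fact M) \<noteq> (0::'a)"
proof
  assume "of_nat (fact M) = (0::'a)"
  then have "\<exists>i. 0 < i \<and> i \<le> M \<and> of_nat i = (0::'a)"
  proof (induction M)
    case (Suc M)
    then have "of_nat (Suc M) = (0::'a) \<or> of_nat (fact M) = (0::'a)"
      by (simp only: fact_Suc of_nat_mult mult_eq_0_iff of_nat_id)
    with Suc.IH show ?case
      by (metis le_SucI le_refl zero_less_Suc)
  qed simp
  then obtain i where i: "0 < i" "i \<le> M" "of_nat i = (0::'a)"
    by blast
  let ?H = "(of_nat :: nat \<Rightarrow> 'a) ` {..<i}"
  have in_H: "of_nat x \<in> ?H" for x
  proof
    have "of_nat x = of_nat i * of_nat (x div i) + (of_nat (x mod i) :: 'a)"
      unfolding of_nat_mult[symmetric] of_nat_add[symmetric] by simp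
    then show "of_nat x = (of_nat (x mod i) :: 'a)"
      using i(3) by simp
  qed (use i in simp)
  have "additive_subgroup ?H"
    unfolding additive_subgroup_def
  proof (intro conjI ballI)
    show "0 \<in> ?H"
      using in_H[of 0] by simp
    show "x + y \<in> ?H" if "x \<in> ?H" "y \<in> ?H" for x y
      using that in_H by (metis imageE of_nat_add)
    show "- x \<in> ?H" if x: "x \<in> ?H" for x
    proof -
      obtain j where "j < i" "x = of_nat j"
        using x by blast
      then have "- x = of_nat (i - j)"
        using i(3) by (simp add: of_nat_diff)
      then show ?thesis
        by (simp only: in_H)
    qed
  qed
  moreover have "?H \<noteq> {0}"
  proof
    assume eq: "?H = {0}"
    have "of_nat 1 \<in> {0::'a}"
      using in_H[of 1] unfolding eq .
    then show False by simp
  qed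
  ultimately have "min_subgroup_order TYPE('a) \<le> enat (card ?H)"
    unfolding min_subgroup_order_def by (intro Inf_lower) blast
  also have "card ?H \<le> M"
    using card_image_le[of "{..<i}" "of_nat :: nat \<Rightarrow> 'a"] i(2) by simp
  finally show False
    using assms by (simp add: leD)
qed

section \<open>The bounds for the restricted signed sumset\<close>

theorem theorem1p5:
  fixes A :: "'a::field set" and h k :: nat and p :: ereal and \<theta> m :: real
  assumes p_def: "p = ereal_of_enat (min_subgroup_order TYPE('a))"
    and "0 < k" and "0 < h" and "2 \<le> h" and "h \<le> k"
    and "ereal (real h - 1) \<le> p"
    and "finite A" and "A \<noteq> {}" and "card A = k"
    and theta_def: "\<theta> = 2 * real h * real k - real h * (3 * real h - 1) / 2
                      - real h * real (card (A \<inter> uminus ` A))"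
    and m_def: "m = real h * real k - (real h)\<^sup>2 + 1"
  shows "(min p (ereal (\<theta> + 1)) \<le> ereal m \<longrightarrow>
            ereal (real (card (restricted_signed_sumset h A))) \<ge> min p (ereal m)) \<and>
         (ereal m < ereal (\<theta> + 1) \<and> ereal (\<theta> + 1) \<le> p \<longrightarrow>
            real (card (restricted_signed_sumset h A)) \<ge> \<theta> + 1) \<and>
         (ereal m < p \<and> p < ereal (\<theta> + 1) \<longrightarrow>
            (let l = (LEAST l::nat. 0 < l \<and>
                        ereal (\<theta> - real l * real h + 1) \<le> p \<and>
                        p < ereal (\<theta> - (real l - 1) * real h + 1))
             in real (card (restricted_signed_sumset h A)) \<ge> max m (\<theta> - real l * real h + 1)))"
proof -
  let ?R = "restricted_signed_sumset h A"
  define w where "w = h * (k - h)"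
  have m: "m = real (w + 1)"
    using \<open>h \<le> k\<close> by (simp add: m_def w_def of_nat_diff power2_eq_square algebra_simps)
  have fact_neq_0: "of_nat (fact M) \<noteq> (0::'a)" if "ereal (real (M + 1)) \<le> p" for M
  proof (rule fact_neq_0_if_less_min_subgroup_order)
    have "ereal_of_enat (enat (M + 1)) \<le> ereal_of_enat (min_subgroup_order TYPE('a))"
      using that unfolding p_def by simp
    then have "enat (M + 1) \<le> min_subgroup_order TYPE('a)"
      by (simp only: ereal_of_enat_le_iff)
    then show "enat M < min_subgroup_order TYPE('a)"
      by (rule less_le_trans[rotated]) simp
  qed
  have unsigned: "M < card ?R" if "M \<le> w" "ereal (real (M + 1)) \<le> p" for M
    using that fact_neq_0[OF that(2)] assms
    by (intro card_restricted_signed_sumset_gt) (simp_all add: w_def)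
  have R_pos: "1 \<le> card ?R"
    using card_restricted_signed_sumset_gt_0[of A h] assms by simp

  define n where "n = card (A \<union> uminus ` A)"
  have n: "real n = 2 * real k - real (card (A \<inter> uminus ` A))"
  proof -
    have "card (uminus ` A) = k"
      using \<open>card A = k\<close> by (subst card_image) simp_all
    then have "n + card (A \<inter> uminus ` A) = 2 * k"
      using card_Un_Int[of A "uminus ` A"] assms by (simp add: n_def)
    then show ?thesis by linarith
  qed
  have theta: "2 * (\<theta> - real l * real h) = 2 * real h * (real n - real l) - real h * (3 * real h - 1)" for l
    unfolding theta_def n by (simp add: field_simps)
  have signed: "\<theta> - real l * real h + 1 \<le> real (card ?R)"
    if two: "(2::'a) \<noteq> 0" and le_p: "ereal (\<theta> - real l * real h + 1) \<le> p" for l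
  proof (cases "\<theta> - real l * real h \<le> 0")
    case True
    then show ?thesis
      using R_pos by linarith
  next
    case False
    have "0 < 2 * real h * (real n - real l) - real h * (3 * real h - 1)"
      unfolding theta[symmetric] using False by simp
    also have "\<dots> \<le> 2 * real h * (real n - real l)"
      using \<open>2 \<le> h\<close> by simp
    finally have "l \<le> n"
      using \<open>2 \<le> h\<close> by (simp add: zero_less_mult_iff)
    have "even (h * (3 * h - 1))"
      by auto
    then obtain q where q: "h * (3 * h - 1) = 2 * q"
      by (rule evenE)
    have q': "real h * (3 * real h - 1) = 2 * real q"
      using arg_cong[OF q, of real] \<open>2 \<le> h\<close> by (simp add: of_nat_diff)
    have eq: "\<theta> - real l * real h = real (h * (n - l)) - real q"
      using theta[of l] \<open>l \<le> n\<close> q' by (simp add: of_nat_diff)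
    define N where "N = h * (n - l) - q"
    have "real q < real (h * (n - l))"
      using False unfolding eq by linarith
    then have "q \<le> h * (n - l)"
      by (simp only: of_nat_less_iff less_imp_le)
    then have Nq: "h * (n - l) = N + q"
      by (simp add: N_def)
    have N: "\<theta> - real l * real h = real N" "2 * N + h * (3 * h - 1) = 2 * h * (n - l)"
      unfolding eq q mult.assoc Nq by simp_all
    have "N < card ?R"
    proof (rule card_restricted_signed_sumset_gt_if_sized[OF \<open>finite A\<close> \<open>2 \<le> h\<close> _ _ two N(2)])
      show "of_nat (fact N) \<noteq> (0::'a)"
        using le_p by (intro fact_neq_0) (simp add: N(1) add.commute)
    qed (use \<open>h \<le> k\<close> \<open>card A = k\<close> in \<open>simp_all add: n_def\<close>)
    then show ?thesis
      unfolding N(1) by simp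
  qed
  have two: "(2::'a) \<noteq> 0" if "m < \<theta> + 1"
  proof
    assume "(2::'a) = 0"
    then have neg: "- a = a" for a :: 'a
      by (metis add_eq_0_iff mult_2 mult_zero_left)
    have "uminus ` A = id ` A"
      by (rule image_cong) (simp_all only: neg id_apply)
    then have "A \<inter> uminus ` A = A"
      by simp
    then have "m - \<theta> - 1 = real h * (real h - 1) / 2"
      using \<open>card A = k\<close> unfolding m_def theta_def by (simp add: power2_eq_square field_simps)
    moreover have "0 \<le> real h * (real h - 1) / 2"
      using \<open>2 \<le> h\<close> by simp
    ultimately show False
      using that by linarith
  qed

  show ?thesis
  proof (intro conjI impI)
    show "min p (ereal m) \<le> ereal (real (card ?R))"
    proof (cases "ereal m \<le> p")
      case True
      then show ?thesis
        using unsigned[of w] by (simp add: m min_def)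
    next
      case False
      then obtain P where P: "min_subgroup_order TYPE('a) = enat P"
        by (cases "min_subgroup_order TYPE('a)") (auto simp: p_def)
      with False have "P \<le> w" "p = ereal (real P)"
        by (auto simp: p_def m)
      then show ?thesis
        using unsigned[of "P - 1"] by (cases P) (auto simp: min_def)
    qed
  next
    assume "ereal m < ereal (\<theta> + 1) \<and> ereal (\<theta> + 1) \<le> p"
    then show "\<theta> + 1 \<le> real (card ?R)"
      using signed[of 0] two by simp
  next
    assume p: "ereal m < p \<and> p < ereal (\<theta> + 1)"
    then obtain P where P: "p = ereal P"
      by (cases p) auto
    let ?good = "\<lambda>l::nat. 0 < l \<and> ereal (\<theta> - real l * real h + 1) \<le> p \<and>
      p < ereal (\<theta> - (real l - 1) * real h + 1)"
    define l where "l = (LEAST l. ?good l)"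
    have "\<exists>l. ?good l"
    proof -
      let ?small = "\<lambda>l::nat. \<theta> - real l * real h + 1 \<le> P"
      have "\<exists>l. ?small l"
      proof -
        obtain l :: nat where "\<theta> + 1 - P < real l * real h"
          using reals_Archimedean3[of "real h"] \<open>0 < h\<close> by auto
        then show ?thesis
          by (intro exI[of _ l]) linarith
      qed
      then have small: "?small (LEAST l. ?small l)"
        by (rule LeastI_ex)
      \<comment> \<open>the first \<open>l\<close> with a small enough bound is positive, and its predecessor is not small enough\<close>
      have "\<not> ?small 0"
        using p P by simp
      then obtain l where l: "(LEAST l. ?small l) = Suc l"
        using small by (cases "LEAST l. ?small l") auto
      have "\<not> ?small l"
        using not_less_Least[of l ?small] l by simp
      then have "?good (Suc l)"
        using small unfolding l by (simp add: P)
      then show ?thesis ..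
    qed
    then have "?good l"
      unfolding l_def by (rule LeastI_ex)
    moreover have "m < \<theta> + 1"
      using p P by auto
    ultimately have "\<theta> - real l * real h + 1 \<le> real (card ?R)"
      using signed two by blast
    moreover have "m \<le> real (card ?R)"
    proof -
      have "ereal (real (w + 1)) \<le> p"
        using p unfolding m by (simp only: less_imp_le)
      from unsigned[OF order.refl this] show ?thesis
        unfolding m by simp
    qed
    ultimately show "let l = LEAST l. ?good l in max m (\<theta> - real l * real h + 1) \<le> real (card ?R)"
      by (simp add: l_def[symmetric])
  qed
qed

end
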